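(* Let $K$ be a field, $S=K[x_1,\ldots,x_n]$, and let $I\subset S$ be a nonzero proper squarefree monomial ideal. Then (a) $\operatorname{reg} S/I\leq\operatorname{cosize} I$; (b) $\operatorname{reg} S/I=\operatorname{cosize} I$, if $\operatorname{bigcosize} I=\operatorname{cosize} I$.
   Context: $\operatorname{reg} M$ denotes the Castelnuovo–Mumford regularity of a finitely generated graded $S$-module $M$ (standard grading). Let $I$ be a squarefree monomial ideal minimally generated by the monomials $u_1,\ldots,u_m$. Let $w$ be the smallest number $t$ such that there exist integers $1\le i_1<i_2<\cdots<i_t\le m$ with $\operatorname{lcm}(u_{i_1},\ldots,u_{i_t})=\operatorname{lcm}(u_1,\ldots,u_m)$. Then $\operatorname{cosize} I=\deg\operatorname{lcm}(u_1,\ldots,u_m)-w$. The number $\operatorname{bigcosize} I$ is defined in the same way, replacing "there exist integers $1\le i_1<\cdots<i_t\le m$" by "for all integers $1\le i_1<\cdots<i_t\le m$"; that is, $\operatorname{bigcosize} I=\deg\operatorname{lcm}(u_1,\ldots,u_m)-w'$ where $w'$ is the smallest $t$ such that every choice of $t$ of the generators has least common multiple equal to $\operatorname{lcm}(u_1,\ldots,u_m)$. *)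

theory Defs
  imports
    "HOL-Library.Poly_Mapping"
    "HOL-Algebra.QuotRing"
    "HOL-Algebra.Module"
    "Jordan_Normal_Form.Matrix_Kernel"
begin

section \<open>Polynomials and squarefree monomial ideals\<close>

text \<open>The variables of \<open>S = K[x\<^sub>1, \<dots>, x\<^sub>n]\<close> are the elements of a finite type \<open>'x\<close> with \<open>n\<close>
  elements; a monomial is identified with its exponent vector, so that multiplication of
  monomials is addition in \<open>'x mono\<close> and the monomial \<open>1\<close> is \<open>0\<close>.\<close>

type_synonym 'x mono = "'x \<Rightarrow>\<^sub>0 nat"
type_synonym ('x, 'k) mpol = "'x mono \<Rightarrow>\<^sub>0 'k"

abbreviation poly_ring :: "('x, 'k :: comm_ring_1) mpol ring" where
  "poly_ring \<equiv> class_ring"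

definition mono_pol :: "'x mono \<Rightarrow> ('x, 'k :: comm_ring_1) mpol" where
  "mono_pol t = Poly_Mapping.single t 1"

definition mono_deg :: "'x::finite mono \<Rightarrow> nat" where
  "mono_deg t = (\<Sum>x\<in>UNIV. Poly_Mapping.lookup t x)"

definition squarefree_mono :: "'x mono \<Rightarrow> bool" where
  "squarefree_mono t \<longleftrightarrow> (\<forall>x. Poly_Mapping.lookup t x \<le> 1)"

text \<open>Least common multiple of a finite set of monomials, with value \<open>1\<close> on the empty set.\<close>

definition mono_lcm :: "'x::finite mono set \<Rightarrow> 'x mono" where
  "mono_lcm U = Abs_poly_mapping (\<lambda>x. Max (insert 0 ((\<lambda>u. Poly_Mapping.lookup u x) ` U)))"

definition mono_ideal :: "'x mono set \<Rightarrow> ('x, 'k :: comm_ring_1) mpol set" where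
  "mono_ideal U = genideal poly_ring (mono_pol ` U)"

definition squarefree_monomial_ideal :: "('x, 'k :: comm_ring_1) mpol set \<Rightarrow> bool" where
  "squarefree_monomial_ideal I \<longleftrightarrow> (\<exists>U. (\<forall>u\<in>U. squarefree_mono u) \<and> I = mono_ideal U)"

definition minimally_generates :: "'x mono set \<Rightarrow> ('x, 'k :: comm_ring_1) mpol set \<Rightarrow> bool" where
  "minimally_generates U I \<longleftrightarrow> mono_ideal U = I \<and> (\<forall>V. V \<subset> U \<longrightarrow> mono_ideal V \<noteq> I)"

text \<open>A monomial ideal has exactly one minimal set of monomial generators.\<close>

definition min_gens :: "('x, 'k :: comm_ring_1) mpol set \<Rightarrow> 'x mono set" where
  "min_gens I = (THE U. minimally_generates U I)"


section \<open>Cosize and big cosize\<close>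

text \<open>Choosing indices \<open>i\<^sub>1 < \<dots> < i\<^sub>t\<close> amounts to choosing a set of \<open>t\<close> minimal generators.\<close>

definition cosize :: "('x::finite, 'k :: comm_ring_1) mpol set \<Rightarrow> int" where
  "cosize I = int (mono_deg (mono_lcm (min_gens I)))
     - int (LEAST t. \<exists>V \<subseteq> min_gens I. card V = t \<and> mono_lcm V = mono_lcm (min_gens I))"

definition bigcosize :: "('x::finite, 'k :: comm_ring_1) mpol set \<Rightarrow> int" where
  "bigcosize I = int (mono_deg (mono_lcm (min_gens I)))
     - int (LEAST t. \<forall>V \<subseteq> min_gens I. card V = t \<longrightarrow> mono_lcm V = mono_lcm (min_gens I))"


section \<open>Graded Betti numbers and Castelnuovo--Mumford regularity\<close>

text \<open>The component \<open>S\<^sub>j\<close>; it contains \<open>0\<close> for every \<open>j\<close> and is \<open>{0}\<close> for \<open>j < 0\<close>.\<close>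

definition homogeneous_polys :: "int \<Rightarrow> ('x::finite, 'k :: comm_ring_1) mpol set" where
  "homogeneous_polys j = {f. \<forall>t\<in>Poly_Mapping.keys f. int (mono_deg t) = j}"

text \<open>A complex of graded free modules of finite rank with an augmentation. In homological degree
  \<open>i\<close> the module is \<open>F\<^sub>i = \<Oplus>\<^bsub>b < rank i\<^esub> S(-shift i b)\<close>, so that its \<open>b\<close>-th basis element has degree
  \<open>shift i b\<close>. The matrix \<open>bdry i\<close> represents the map from \<open>F\<^bsub>i+1\<^esub>\<close> to \<open>F\<^sub>i\<close>, and \<open>aug b\<close> is the image
  in the resolved module of the \<open>b\<close>-th basis element of \<open>F\<^sub>0\<close>.\<close>

record (overloaded) ('x, 'k, 'm) free_complex =
  rank :: "nat \<Rightarrow> nat"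
  shift :: "nat \<Rightarrow> nat \<Rightarrow> int"
  bdry :: "nat \<Rightarrow> ('x, 'k) mpol mat"
  aug :: "nat \<Rightarrow> 'm"

definition aug_map :: "(('x, 'k :: comm_ring_1) mpol, 'm) module \<Rightarrow> ('x, 'k, 'm) free_complex
    \<Rightarrow> ('x, 'k) mpol vec \<Rightarrow> 'm" where
  "aug_map M F v = finsum M (\<lambda>b. v $ b \<odot>\<^bsub>M\<^esub> aug F b) {..<rank F 0}"

text \<open>\<open>F\<close> is a graded free resolution of the module \<open>M\<close> whose component of degree \<open>j\<close> is \<open>G j\<close>.\<close>

definition graded_free_resolution :: "(('x::finite, 'k :: field) mpol, 'm) module
    \<Rightarrow> (int \<Rightarrow> 'm set) \<Rightarrow> ('x, 'k, 'm) free_complex \<Rightarrow> bool" where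
  "graded_free_resolution M G F \<longleftrightarrow>
     (\<forall>i. bdry F i \<in> carrier_mat (rank F i) (rank F (Suc i))) \<and>
     (\<forall>i. \<forall>a < rank F i. \<forall>b < rank F (Suc i).
        bdry F i $$ (a, b) \<in> homogeneous_polys (shift F (Suc i) b - shift F i a)) \<and>
     (\<forall>b < rank F 0. aug F b \<in> G (shift F 0 b)) \<and>
     aug_map M F ` carrier_vec (rank F 0) = carrier M \<and>
     {v \<in> carrier_vec (rank F 0). aug_map M F v = \<zero>\<^bsub>M\<^esub>}
       = (*\<^sub>v) (bdry F 0) ` carrier_vec (rank F 1) \<and>
     (\<forall>i. mat_kernel (bdry F i)
       = (*\<^sub>v) (bdry F (Suc i)) ` carrier_vec (rank F (Suc (Suc i))))"

text \<open>Minimality: all maps between the free modules vanish modulo the ideal generated by the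
  variables, that is, the entries of their matrices have constant term \<open>0\<close>.\<close>

definition minimal_graded_free_resolution :: "(('x::finite, 'k :: field) mpol, 'm) module
    \<Rightarrow> (int \<Rightarrow> 'm set) \<Rightarrow> ('x, 'k, 'm) free_complex \<Rightarrow> bool" where
  "minimal_graded_free_resolution M G F \<longleftrightarrow> graded_free_resolution M G F \<and>
     (\<forall>i. \<forall>a < rank F i. \<forall>b < rank F (Suc i). Poly_Mapping.lookup (bdry F i $$ (a, b)) 0 = 0)"

text \<open>Every finitely generated graded module has a minimal graded free resolution, and the graded
  Betti numbers do not depend on which one is chosen.\<close>

definition graded_betti :: "(('x::finite, 'k :: field) mpol, 'm) module
    \<Rightarrow> (int \<Rightarrow> 'm set) \<Rightarrow> nat \<Rightarrow> int \<Rightarrow> nat" where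
  "graded_betti M G i j = (let F = SOME F. minimal_graded_free_resolution M G F
     in card {b. b < rank F i \<and> shift F i b = j})"

text \<open>By Hilbert's syzygy theorem the set is finite for finitely generated \<open>M\<close>; it is nonempty
  if \<open>M\<close> is moreover nonzero.\<close>

definition regularity :: "(('x::finite, 'k :: field) mpol, 'm) module
    \<Rightarrow> (int \<Rightarrow> 'm set) \<Rightarrow> int" where
  "regularity M G = Max {j - int i | i j. graded_betti M G i j \<noteq> 0}"


section \<open>The graded module \<open>S/I\<close>\<close>

definition quot_module :: "('x, 'k :: comm_ring_1) mpol set
    \<Rightarrow> (('x, 'k) mpol, ('x, 'k) mpol set) module" where
  "quot_module I = ring.extend (poly_ring Quot I)
     (module.fields (\<lambda>f X. (I +>\<^bsub>poly_ring\<^esub> f) \<otimes>\<^bsub>poly_ring Quot I\<^esub> X))"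

definition quot_grading :: "('x::finite, 'k :: comm_ring_1) mpol set \<Rightarrow> int
    \<Rightarrow> ('x, 'k) mpol set set" where
  "quot_grading I j = (\<lambda>f. I +>\<^bsub>poly_ring\<^esub> f) ` homogeneous_polys j"

end

theory Submission
  imports Defs
begin

text \<open>Let \<open>G\<close> be the set of minimal generators of \<open>I\<close>, let \<open>d\<close> be the degree of its least common multiple,
and let \<open>w\<close> be the least number of generators with the same least common multiple as \<open>G\<close>. The Taylor
complex of \<open>G\<close> is a graded free resolution of \<open>S/I\<close> (\<open>taylor_resolves\<close>). Its basis elements in
homological degree \<open>i\<close> are the subsets of \<open>G\<close> with \<open>i\<close> elements, placed in the degree of their least
common multiple. A minimal resolution has basis elements only in positions \<open>(i, j)\<close> where every other
resolution has some (\<open>minimal_resolution_is_smallest\<close>).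

So if the Betti number at \<open>(i, j)\<close> is not \<open>0\<close>, then \<open>i\<close> of the generators have a least common multiple of
degree \<open>j\<close>. Adding one generator that does not divide it raises its degree by at least one; hence at
most \<open>d - j\<close> further generators suffice to reach the least common multiple of \<open>G\<close>
(\<open>extend_to_full_lcm\<close>). This gives \<open>w \<le> i + (d - j)\<close>, that is \<open>j - i \<le> d - w\<close>, the upper
bound for the regularity.

If big cosize and cosize agree, then a subset of \<open>G\<close> has the full least common multiple if and only
if it has at least \<open>w\<close> elements. Let \<open>\<sigma>\<close> be a subset with exactly \<open>w\<close> elements. Modulo the variables
it is a cycle of the Taylor complex, because its facets lie in smaller degree. If the minimal
resolution had no basis element in position \<open>(w, d)\<close>, then \<open>\<sigma>\<close> would be a boundary modulo the
variables (\<open>cycle_mod_maximal_is_boundary\<close>). But on sets with at least \<open>w\<close> elements the Taylor complex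
modulo the variables is the chain complex of a simplex, and there \<open>\<sigma>\<close> is no boundary since its own
simplicial boundary is not \<open>0\<close> (\<open>taylor_top_class\<close>). So the bound \<open>d - w\<close>
is attained.

Both facts about minimal resolutions follow from the homotopy between a composite of comparison
maps and the identity (\<open>round_trip_homotopy\<close>), by looking at constant terms. That a minimal resolution
exists is seen by cancelling unit entries in the matrices of the Taylor resolution
(\<open>resolves_trim\<close>).\<close>

lemma class_ring_eqs [simp]:
  "carrier (poly_ring :: ('x, 'k::comm_ring_1) mpol ring) = UNIV"
  "mult (poly_ring :: ('x, 'k::comm_ring_1) mpol ring) = (*)"
  "add (poly_ring :: ('x, 'k::comm_ring_1) mpol ring) = (+)"
  "zero (poly_ring :: ('x, 'k::comm_ring_1) mpol ring) = 0"
  "one (poly_ring :: ('x, 'k::comm_ring_1) mpol ring) = 1"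
  by (simp_all add: class_ring_simps)

section \<open>Monomials, divisibility and graded components\<close>

abbreviation lk where "lk \<equiv> Poly_Mapping.lookup"

text \<open>A monomial is its exponent vector, so divisibility is the pointwise order of exponents.\<close>

definition mono_dvd :: "'x mono \<Rightarrow> 'x mono \<Rightarrow> bool" where
  "mono_dvd s t \<longleftrightarrow> (\<forall>x. lk s x \<le> lk t x)"

lemma mono_dvd_refl [simp]: "mono_dvd s s"
  by (simp add: mono_dvd_def)

lemma mono_dvd_trans: "mono_dvd s t \<Longrightarrow> mono_dvd t u \<Longrightarrow> mono_dvd s u"
  unfolding mono_dvd_def using order_trans by blast

lemma mono_dvd_antisym: "mono_dvd s t \<Longrightarrow> mono_dvd t s \<Longrightarrow> s = t"
  by (intro poly_mapping_eqI) (simp add: mono_dvd_def eq_iff)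

lemma mono_dvd_add [simp]: "mono_dvd s (s + t)" "mono_dvd s (t + s)"
  by (simp_all add: mono_dvd_def lookup_add)

lemma mono_minus_add: "mono_dvd s t \<Longrightarrow> t - s + s = t" "mono_dvd s t \<Longrightarrow> s + (t - s) = t"
  by (auto intro!: poly_mapping_eqI simp: mono_dvd_def lookup_add minus_poly_mapping.rep_eq)

lemma add_eq_mono_iff: "(t = s + q) \<longleftrightarrow> mono_dvd s t \<and> q = t - s" for s t q :: "'x mono"
  by (metis add_diff_cancel_left' mono_dvd_add(1) mono_minus_add(2))

lemma zero_eq_add_mono_iff: "(0 = s + q) \<longleftrightarrow> s = 0 \<and> q = 0" for s q :: "'x mono"
  by (auto simp: poly_mapping_eq_iff fun_eq_iff lookup_add)

lemma mono_deg_add: "mono_deg (s + t) = mono_deg s + mono_deg t"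
  by (simp add: mono_deg_def lookup_add sum.distrib)

lemma mono_deg_0 [simp]: "mono_deg 0 = 0"
  by (simp add: mono_deg_def)

lemma mono_deg_minus: "mono_dvd s t \<Longrightarrow> int (mono_deg (t - s)) = int (mono_deg t) - int (mono_deg s)"
  using mono_deg_add[of "t - s" s] by (simp add: mono_minus_add)

lemma mono_deg_mono: "mono_dvd s t \<Longrightarrow> mono_deg s \<le> mono_deg t"
  by (metis le_add1 mono_deg_add mono_minus_add(2))

lemma mono_deg_eq_imp: "mono_dvd s t \<Longrightarrow> mono_deg s = mono_deg t \<Longrightarrow> s = t"
proof -
  assume st: "mono_dvd s t" and eq: "mono_deg s = mono_deg t"
  have "mono_deg (t - s) = 0" using mono_deg_minus[OF st] eq by simp
  then have "t - s = 0" by (intro poly_mapping_eqI) (simp add: mono_deg_def)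
  then show ?thesis using mono_minus_add(1)[OF st] by simp
qed

lemma lookup_monom_times:
  fixes p :: "('x, 'k::comm_ring_1) mpol"
  shows "lk (Poly_Mapping.single s c * p) t = (if mono_dvd s t then c * lk p (t - s) else 0)"
proof -
  have "lk (Poly_Mapping.single s c * p) t
      = (\<Sum>l. (c * (\<Sum>q. lk p q when t = s + q)) when l = s)"
    unfolding lookup_mult by (intro Sum_any.cong) (simp add: lookup_single when_def)
  also have "\<dots> = c * (\<Sum>q. (lk p q when mono_dvd s t) when q = t - s)"
    by (simp add: add_eq_mono_iff when_when conj_commute cong: when_cong)
  finally show ?thesis by simp
qed

text \<open>Taking constant terms is reduction modulo the ideal of the variables. It is multiplicative because
two monomials have product \<open>1\<close> only if both are \<open>1\<close>.\<close>

lemma lookup_times_zero: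
  fixes p q :: "('x, 'k::comm_ring_1) mpol"
  shows "lk (p * q) 0 = lk p 0 * lk q 0"
proof -
  have "lk (p * q) 0 = (\<Sum>l::'x mono. (lk p 0 * lk q 0) when l = 0)"
    unfolding lookup_mult
  proof (intro Sum_any.cong)
    fix l :: "'x mono"
    have "(\<Sum>r. lk q r when 0 = l + r) = (\<Sum>r. (lk q r when l = 0) when r = 0)"
      by (intro Sum_any.cong) (auto simp: zero_eq_add_mono_iff when_def)
    then show "lk p l * (\<Sum>r. lk q r when 0 = l + r) = (lk p 0 * lk q 0 when l = 0)"
      by (auto simp: when_def)
  qed
  then show ?thesis by simp
qed

definition hom_component :: "int \<Rightarrow> ('x::finite, 'k::comm_ring_1) mpol \<Rightarrow> ('x, 'k) mpol" where
  "hom_component j p = Poly_Mapping.mapp (\<lambda>t c. if int (mono_deg t) = j then c else 0) p"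

lemma lookup_hpart: "lk (hom_component j p) t = (if int (mono_deg t) = j then lk p t else 0)"
  by (auto simp: hom_component_def lookup_mapp when_def in_keys_iff)

lemma hom_iff: "p \<in> homogeneous_polys j \<longleftrightarrow> (\<forall>t. lk p t \<noteq> 0 \<longrightarrow> int (mono_deg t) = j)"
  by (auto simp: homogeneous_polys_def in_keys_iff)

lemma hom_component_hom [simp]: "hom_component j p \<in> homogeneous_polys j"
  by (simp add: hom_iff lookup_hpart)

lemma hom_component_id: "p \<in> homogeneous_polys j \<Longrightarrow> hom_component j p = p"
  by (intro poly_mapping_eqI) (auto simp: hom_iff lookup_hpart)

lemma hom_component_add: "hom_component j (p + q) = hom_component j p + hom_component j q"
  by (intro poly_mapping_eqI) (simp add: lookup_hpart lookup_add)

lemma hom_component_diff: "hom_component j (p - q) = hom_component j p - hom_component j q"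
  by (intro poly_mapping_eqI) (simp add: lookup_hpart lookup_minus)

lemma hom_component_zero: "hom_component j 0 = 0"
  by (intro poly_mapping_eqI) (simp add: lookup_hpart)

lemma hom_component_sum: "hom_component j (sum f A) = (\<Sum>a\<in>A. hom_component j (f a))"
  by (induction A rule: infinite_finite_induct) (simp_all add: hom_component_zero hom_component_add)

text \<open>Multiplication by a homogeneous polynomial shifts components. Hence a solution of a linear system
with homogeneous data remains a solution when each unknown is replaced by its component of the
appropriate degree.\<close>

lemma hom_component_mult:
  assumes "p \<in> homogeneous_polys k"
  shows "hom_component j (p * q) = p * hom_component (j - k) q"
proof (intro poly_mapping_eqI)
  fix t
  have "lk (p * hom_component (j - k) q) t
      = (\<Sum>l. lk p l * (\<Sum>r. (if int (mono_deg t) = j then lk q r else 0) when t = l + r))"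
    unfolding lookup_mult
  proof (intro Sum_any.cong)
    fix l
    show "lk p l * (\<Sum>r. lk (hom_component (j - k) q) r when t = l + r)
        = lk p l * (\<Sum>r. (if int (mono_deg t) = j then lk q r else 0) when t = l + r)"
    proof (cases "lk p l = 0")
      case False
      then have "int (mono_deg l) = k" using assms by (simp add: hom_iff)
      then have "(lk (hom_component (j - k) q) r when t = l + r)
          = ((if int (mono_deg t) = j then lk q r else 0) when t = l + r)" for r
        by (auto simp: lookup_hpart mono_deg_add when_def)
      then show ?thesis by simp
    qed simp
  qed
  then show "lk (hom_component j (p * q)) t = lk (p * hom_component (j - k) q) t"
    by (simp add: lookup_hpart lookup_mult)
qed

lemma hom_zero [simp]: "0 \<in> homogeneous_polys j"
  by (simp add: hom_iff)

lemma hom_single: "Poly_Mapping.single t c \<in> homogeneous_polys (int (mono_deg t))"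
  by (auto simp: hom_iff lookup_single when_def)

lemma hom_one: "1 \<in> homogeneous_polys 0"
  using hom_single[of 0 1] by simp

lemma hom_diff:  "p \<in> homogeneous_polys j \<Longrightarrow> q \<in> homogeneous_polys j \<Longrightarrow> p - q \<in> homogeneous_polys j"
  unfolding hom_iff lookup_minus by (metis diff_self)

lemma hom_add: "p \<in> homogeneous_polys j \<Longrightarrow> q \<in> homogeneous_polys j \<Longrightarrow> p + q \<in> homogeneous_polys j"
  unfolding hom_iff lookup_add by (metis add_0)

lemma hom_sum: "(\<And>a. a \<in> A \<Longrightarrow> f a \<in> homogeneous_polys j) \<Longrightarrow> sum f A \<in> homogeneous_polys j"
  by (induction A rule: infinite_finite_induct) (auto intro: hom_add)

lemma hom_mult:
  assumes "p \<in> homogeneous_polys j" "q \<in> homogeneous_polys k"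
  shows "p * q \<in> homogeneous_polys (j + k)"
proof -
  have "p * q = hom_component (j + k) (p * q)"
    using assms by (simp add: hom_component_mult hom_component_id)
  then show ?thesis by (metis hom_component_hom)
qed

lemma hom_mult':
  "p \<in> homogeneous_polys j \<Longrightarrow> q \<in> homogeneous_polys k \<Longrightarrow> i = j + k \<Longrightarrow> p * q \<in> homogeneous_polys i"
  using hom_mult by blast

lemma hom_const_term: "p \<in> homogeneous_polys j \<Longrightarrow> j \<noteq> 0 \<Longrightarrow> lk p 0 = 0"
  by (auto simp: hom_iff)

lemma hom_deg_0_const:
  fixes p :: "('x::finite, 'k::comm_ring_1) mpol"
  assumes "p \<in> homogeneous_polys 0"
  shows "p = Poly_Mapping.single 0 (lk p 0)"
proof (intro poly_mapping_eqI)
  fix t :: "'x mono"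
  have "t = 0" if "mono_deg t = 0" using mono_deg_eq_imp[of 0 t] that by (simp add: mono_dvd_def)
  then show "lk p t = lk (Poly_Mapping.single 0 (lk p 0)) t"
    using assms by (auto simp: hom_iff lookup_single when_def)
qed

text \<open>The properties of a monomial ideal on which the comparison of resolutions rests.\<close>

definition graded_ideal :: "('x::finite, 'k::comm_ring_1) mpol set \<Rightarrow> bool" where
  "graded_ideal I \<longleftrightarrow> 0 \<in> I \<and> (\<forall>p\<in>I. \<forall>q\<in>I. p + q \<in> I) \<and> (\<forall>p\<in>I. \<forall>q. q * p \<in> I)
     \<and> (\<forall>p\<in>I. \<forall>j. hom_component j p \<in> I)"

lemma graded_idealD:
  assumes "graded_ideal I"
  shows "0 \<in> I" "\<And>p q. p \<in> I \<Longrightarrow> q \<in> I \<Longrightarrow> p + q \<in> I" "\<And>p q. p \<in> I \<Longrightarrow> q * p \<in> I"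
    "\<And>p q. p \<in> I \<Longrightarrow> p * q \<in> I" "\<And>p j. p \<in> I \<Longrightarrow> hom_component j p \<in> I"
    "\<And>p. p \<in> I \<Longrightarrow> - p \<in> I" "\<And>p q. p \<in> I \<Longrightarrow> q \<in> I \<Longrightarrow> p - q \<in> I"
proof -
  show 1: "0 \<in> I" "\<And>p q. p \<in> I \<Longrightarrow> q \<in> I \<Longrightarrow> p + q \<in> I" "\<And>p q. p \<in> I \<Longrightarrow> q * p \<in> I"
    "\<And>p j. p \<in> I \<Longrightarrow> hom_component j p \<in> I" using assms by (auto simp: graded_ideal_def)
  show "\<And>p q. p \<in> I \<Longrightarrow> p * q \<in> I" using 1(3) by (simp add: mult.commute)
  show 2: "\<And>p. p \<in> I \<Longrightarrow> - p \<in> I" using 1(3)[of _ "-1"] by simp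
  show "\<And>p q. p \<in> I \<Longrightarrow> q \<in> I \<Longrightarrow> p - q \<in> I" using 1(2) 2 by (metis diff_conv_add_uminus)
qed

lemma graded_ideal_sum: "graded_ideal I \<Longrightarrow> (\<And>a. a \<in> A \<Longrightarrow> f a \<in> I) \<Longrightarrow> sum f A \<in> I"
  by (induction A rule: infinite_finite_induct) (auto intro: graded_idealD)

lemma keys_mult_add: "t \<in> Poly_Mapping.keys (p * q) \<Longrightarrow>
   \<exists>a b. a \<in> Poly_Mapping.keys p \<and> b \<in> Poly_Mapping.keys q \<and> t = a + b"
  using keys_mult by blast

text \<open>The polynomials on the right form an ideal because divisibility by a generator passes to multiples
of a monomial. Conversely such a polynomial is the sum of its terms, each of which is a multiple of
a generator.\<close>

lemma mono_ideal_eq: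
  "mono_ideal U = {p :: ('x, 'k::comm_ring_1) mpol. \<forall>t. lk p t \<noteq> 0 \<longrightarrow> (\<exists>u\<in>U. mono_dvd u t)}"
    (is "_ = ?R")
proof
  have "ideal ?R poly_ring"
  proof (rule idealI)
    show "ring (poly_ring :: ('x, 'k) mpol ring)" by (rule class_ring.ring_axioms)
    show "subgroup ?R (add_monoid poly_ring)"
    proof (rule subgroup.intro, goal_cases)
      case (2 x y)
      then show ?case by (auto simp: lookup_add) (metis add.right_neutral)
    next
      case (4 x)
      have "inv\<^bsub>add_monoid poly_ring\<^esub> x = - x"
        by (simp only: a_inv_def[symmetric] class_ring_simps(8))
      then show ?case using 4 by simp
    qed simp_all
    have *: "x * a \<in> ?R" if "a \<in> ?R" for a x
    proof (clarsimp, goal_cases)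
      case (1 t)
      then obtain b c where bc: "c \<in> Poly_Mapping.keys a" "t = b + c"
        by (metis in_keys_iff keys_mult_add)
      with that obtain u where "u \<in> U" "mono_dvd u c" by (auto simp: in_keys_iff)
      then show ?case using bc mono_dvd_trans mono_dvd_add by metis
    qed
    show "x \<otimes>\<^bsub>poly_ring\<^esub> a \<in> ?R" "a \<otimes>\<^bsub>poly_ring\<^esub> x \<in> ?R"
      if "a \<in> ?R" "x \<in> carrier poly_ring" for a x
      using *[OF that(1), of x] by (simp_all add: mult.commute)
  qed
  moreover have "mono_pol ` U \<subseteq> ?R"
    by (auto simp: mono_pol_def lookup_single when_def intro: mono_dvd_refl split: if_splits)
  ultimately show "mono_ideal U \<subseteq> ?R"
    unfolding mono_ideal_def by (rule ring.genideal_minimal[OF class_ring.ring_axioms])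
  show "?R \<subseteq> mono_ideal U"
  proof
    fix p assume p: "p \<in> ?R"
    have id: "ideal (mono_ideal U :: ('x, 'k) mpol set) poly_ring"
      unfolding mono_ideal_def by (rule ring.genideal_ideal[OF class_ring.ring_axioms]) simp
    interpret J: ideal "mono_ideal U :: ('x, 'k) mpol set" poly_ring by (rule id)
    have tm: "Poly_Mapping.single t (lk p t) \<in> mono_ideal U" for t
    proof (cases "lk p t = 0")
      case True
      then show ?thesis using J.zero_closed by simp
    next
      case False
      with p obtain u where u: "u \<in> U" "mono_dvd u t" by blast
      have "mono_pol u \<in> (mono_ideal U :: ('x, 'k) mpol set)"
        using u ring.genideal_self[OF class_ring.ring_axioms, of "mono_pol ` U :: ('x, 'k) mpol set"] unfolding mono_ideal_def by auto
      from J.I_l_closed[OF this, of "Poly_Mapping.single (t - u) (lk p t)"]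
      show ?thesis using u by (simp add: mono_pol_def mult_single mono_minus_add)
    qed
    have "(\<Sum>t\<in>A. Poly_Mapping.single t (lk p t)) \<in> mono_ideal U" for A
      by (induction A rule: infinite_finite_induct)
        (use J.zero_closed J.a_closed tm in auto)
    moreover have "(\<Sum>t\<in>Poly_Mapping.keys p. Poly_Mapping.single t (lk p t)) = p"
      by (intro poly_mapping_eqI) (simp add: lookup_sum lookup_single when_def in_keys_iff)
    ultimately show "p \<in> mono_ideal U" by metis
  qed
qed

lemma graded_ideal_mono_ideal: "graded_ideal (mono_ideal U)"
proof -
  have "q * p \<in> mono_ideal U" if "p \<in> mono_ideal U" for p q
    unfolding mono_ideal_eq
  proof (clarsimp, goal_cases)
    case (1 t)
    then obtain b c where bc: "c \<in> Poly_Mapping.keys p" "t = b + c"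
      by (metis in_keys_iff keys_mult_add)
    with that obtain u where "u \<in> U" "mono_dvd u c" by (auto simp: in_keys_iff mono_ideal_eq)
    then show ?case using bc mono_dvd_trans mono_dvd_add by metis
  qed
  moreover have "p + q \<in> mono_ideal U" if "p \<in> mono_ideal U" "q \<in> mono_ideal U" for p q
    using that unfolding mono_ideal_eq by (auto simp: lookup_add) (metis add.right_neutral)
  moreover have "hom_component j p \<in> mono_ideal U" if "p \<in> mono_ideal U" for p j
    using that by (auto simp: mono_ideal_eq lookup_hpart)
  moreover have "0 \<in> mono_ideal U" by (simp add: mono_ideal_eq)
  ultimately show ?thesis unfolding graded_ideal_def by blast
qed

section \<open>Graded free resolutions over arbitrary index sets\<close>

text \<open>A vector of the free module in homological degree \<open>i\<close> is a function on the index type, of which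
only the values on \<open>B i\<close> matter. The augmentation into \<open>S/I\<close> is represented by polynomials \<open>f b\<close> in
\<open>S\<close>, so that its kernel is described by membership in \<open>I\<close>. With this convention being a cycle makes
sense in degree \<open>0\<close> too, and exactness is the same condition in all degrees.\<close>

definition cycle :: "('x::finite, 'k::comm_ring_1) mpol set \<Rightarrow> (nat \<Rightarrow> 'b set)
    \<Rightarrow> (nat \<Rightarrow> 'b \<Rightarrow> 'b \<Rightarrow> ('x, 'k) mpol) \<Rightarrow> ('b \<Rightarrow> ('x, 'k) mpol) \<Rightarrow> nat
    \<Rightarrow> ('b \<Rightarrow> ('x, 'k) mpol) \<Rightarrow> bool" where
  "cycle I B D f i v = (case i of 0 \<Rightarrow> (\<Sum>b\<in>B 0. f b * v b) \<in> I
     | Suc j \<Rightarrow> \<forall>a\<in>B j. (\<Sum>b\<in>B (Suc j). D j a b * v b) = 0)"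

lemma cycle_0: "cycle I B D f 0 v \<longleftrightarrow> (\<Sum>b\<in>B 0. f b * v b) \<in> I"
  and cycle_Suc: "cycle I B D f (Suc j) v \<longleftrightarrow> (\<forall>a\<in>B j. (\<Sum>b\<in>B (Suc j). D j a b * v b) = 0)"
  by (simp_all add: cycle_def)

text \<open>A graded free resolution of \<open>S/I\<close> whose modules have bases indexed by arbitrary finite sets: subsets
of the generators for the Taylor resolution, initial segments of the natural numbers for the
resolutions that define Betti numbers. The augmentation is onto as soon as it hits \<open>1\<close> modulo \<open>I\<close>.\<close>

definition resolves :: "('x::finite, 'k::comm_ring_1) mpol set \<Rightarrow> (nat \<Rightarrow> 'b set) \<Rightarrow> (nat \<Rightarrow> 'b \<Rightarrow> int)
    \<Rightarrow> (nat \<Rightarrow> 'b \<Rightarrow> 'b \<Rightarrow> ('x, 'k) mpol) \<Rightarrow> ('b \<Rightarrow> ('x, 'k) mpol) \<Rightarrow> bool" where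
  "resolves I B dg D f \<longleftrightarrow>
     (\<forall>i. finite (B i)) \<and>
     (\<forall>i. \<forall>a\<in>B i. \<forall>b\<in>B (Suc i). D i a b \<in> homogeneous_polys (dg (Suc i) b - dg i a)) \<and>
     (\<forall>b\<in>B 0. f b \<in> homogeneous_polys (dg 0 b)) \<and>
     (\<exists>v. (\<Sum>b\<in>B 0. f b * v b) - 1 \<in> I) \<and>
     (\<forall>i v. cycle I B D f i v \<longleftrightarrow> (\<exists>y. \<forall>a\<in>B i. v a = (\<Sum>b\<in>B (Suc i). D i a b * y b)))"

definition minimal_maps :: "(nat \<Rightarrow> 'b set) \<Rightarrow> (nat \<Rightarrow> 'b \<Rightarrow> 'b \<Rightarrow> ('x, 'k::zero) mpol) \<Rightarrow> bool" where
  "minimal_maps B D \<longleftrightarrow> (\<forall>i. \<forall>a\<in>B i. \<forall>b\<in>B (Suc i). lk (D i a b) 0 = 0)"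

definition mprod :: "'b set \<Rightarrow> ('a \<Rightarrow> 'b \<Rightarrow> 'r::comm_ring_1) \<Rightarrow> ('b \<Rightarrow> 'c \<Rightarrow> 'r) \<Rightarrow> 'a \<Rightarrow> 'c \<Rightarrow> 'r" where
  "mprod B X Y a c = (\<Sum>b\<in>B. X a b * Y b c)"

lemma sum_unit_vector:
  fixes x :: "'b \<Rightarrow> 'r::comm_ring_1"
  assumes "finite B" "c \<in> B"
  shows "(\<Sum>b\<in>B. x b * (if b = c then 1 else 0)) = x c"
    and "(\<Sum>b\<in>B. (if c = b then 1 else 0) * x b) = x c"
proof -
  have "(\<Sum>b\<in>B. x b * (if b = c then 1 else 0)) = (\<Sum>b\<in>B. if b = c then x b else 0)"
    by (intro sum.cong) auto
  then show "(\<Sum>b\<in>B. x b * (if b = c then 1 else 0)) = x c" using assms by simp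
  have "(\<Sum>b\<in>B. (if c = b then 1 else 0) * x b) = (\<Sum>b\<in>B. if b = c then x b else 0)"
    by (intro sum.cong) auto
  then show "(\<Sum>b\<in>B. (if c = b then 1 else 0) * x b) = x c" using assms by simp
qed

lemma mprod_assoc: "mprod C (mprod B X Y) Z = mprod B X (mprod C Y Z)"
proof (intro ext)
  fix a d
  have "mprod C (mprod B X Y) Z a d = (\<Sum>c\<in>C. \<Sum>b\<in>B. X a b * Y b c * Z c d)"
    by (simp add: mprod_def sum_distrib_right)
  also have "\<dots> = (\<Sum>b\<in>B. \<Sum>c\<in>C. X a b * Y b c * Z c d)" by (rule sum.swap)
  also have "\<dots> = mprod B X (mprod C Y Z) a d" by (simp add: mprod_def sum_distrib_left mult.assoc)
  finally show "mprod C (mprod B X Y) Z a d = mprod B X (mprod C Y Z) a d" .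
qed

lemma mprod_cong:
  "(\<And>b. b \<in> B \<Longrightarrow> X a b = X' a b) \<Longrightarrow> (\<And>b. b \<in> B \<Longrightarrow> Y b c = Y' b c) \<Longrightarrow> mprod B X Y a c = mprod B X' Y' a c"
  unfolding mprod_def by (intro sum.cong) auto

lemma mprod_diff_right: "mprod B X (\<lambda>b c. Y b c - Z b c) a c = mprod B X Y a c - mprod B X Z a c"
  by (simp add: mprod_def right_diff_distrib sum_subtractf)

lemma mprod_diff_left: "mprod B (\<lambda>a b. X a b - Y a b) Z a c = mprod B X Z a c - mprod B Y Z a c"
  by (simp add: mprod_def left_diff_distrib sum_subtractf)

lemma hom_mprod:
  "(\<And>b. b \<in> B \<Longrightarrow> X a b \<in> homogeneous_polys (e b - d a)) \<Longrightarrow>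
   (\<And>b. b \<in> B \<Longrightarrow> Y b c \<in> homogeneous_polys (g c - e b)) \<Longrightarrow> mprod B X Y a c \<in> homogeneous_polys (g c - d a)"
  unfolding mprod_def by (intro hom_sum hom_mult') auto

context
  fixes I :: "('x::finite, 'k::field) mpol set" and B :: "nat \<Rightarrow> 'b set" and dg D f
  assumes I: "graded_ideal I" and res: "resolves I B dg D f"
begin

lemma res_finite: "finite (B i)"
  and res_hom: "a \<in> B i \<Longrightarrow> b \<in> B (Suc i) \<Longrightarrow> D i a b \<in> homogeneous_polys (dg (Suc i) b - dg i a)"
  and res_hom_aug: "b \<in> B 0 \<Longrightarrow> f b \<in> homogeneous_polys (dg 0 b)"
  and res_surj: "\<exists>v. (\<Sum>b\<in>B 0. f b * v b) - 1 \<in> I"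
  and res_exact: "cycle I B D f i v \<longleftrightarrow> (\<exists>y. \<forall>a\<in>B i. v a = (\<Sum>b\<in>B (Suc i). D i a b * y b))"
  using res unfolding resolves_def by (elim conjE, (simp only: | blast))+

lemma res_lift:
  assumes "\<And>c. c \<in> C \<Longrightarrow> cycle I B D f i (\<lambda>a. X a c)"
  shows "\<exists>Y. \<forall>a\<in>B i. \<forall>c\<in>C. mprod (B (Suc i)) (D i) Y a c = X a c"
proof -
  have "\<forall>c\<in>C. \<exists>y. \<forall>a\<in>B i. X a c = (\<Sum>b\<in>B (Suc i). D i a b * y b)"
    using assms res_exact by simp
  then obtain Y where "\<forall>c\<in>C. \<forall>a\<in>B i. X a c = (\<Sum>b\<in>B (Suc i). D i a b * Y c b)" by metis
  then show ?thesis by (intro exI[of _ "\<lambda>b c. Y c b"]) (simp add: mprod_def)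
qed

text \<open>Exactness lifts every column of \<open>X\<close>. Since the maps are homogeneous, cutting the entries of the lift
down to the components of the right degrees does not change its image.\<close>

lemma res_lift_hom:
  assumes "\<And>c. c \<in> C \<Longrightarrow> cycle I B D f i (\<lambda>a. X a c)"
    and "\<And>a c. a \<in> B i \<Longrightarrow> c \<in> C \<Longrightarrow> X a c \<in> homogeneous_polys (e c - dg i a)"
  shows "\<exists>Y. (\<forall>a\<in>B i. \<forall>c\<in>C. mprod (B (Suc i)) (D i) Y a c = X a c) \<and>
     (\<forall>b\<in>B (Suc i). \<forall>c\<in>C. Y b c \<in> homogeneous_polys (e c - dg (Suc i) b))"
proof -
  have "\<exists>Y. \<forall>a\<in>B i. \<forall>c\<in>C. mprod (B (Suc i)) (D i) Y a c = X a c"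
    by (rule res_lift) (rule assms(1))
  then obtain Y where Y: "\<forall>a\<in>B i. \<forall>c\<in>C. mprod (B (Suc i)) (D i) Y a c = X a c" ..
  define Z where "Z b c = hom_component (e c - dg (Suc i) b) (Y b c)" for b c
  have "mprod (B (Suc i)) (D i) Z a c = X a c" if ac: "a \<in> B i" "c \<in> C" for a c
  proof -
    have "X a c = hom_component (e c - dg i a) (mprod (B (Suc i)) (D i) Y a c)"
      unfolding Y[rule_format, OF ac] by (rule hom_component_id[OF assms(2)[OF ac], symmetric])
    also have "\<dots> = mprod (B (Suc i)) (D i) Z a c"
      unfolding mprod_def hom_component_sum
    proof (intro sum.cong refl)
      fix b assume "b \<in> B (Suc i)"
      then have "hom_component (e c - dg i a) (D i a b * Y b c)
          = D i a b * hom_component (e c - dg i a - (dg (Suc i) b - dg i a)) (Y b c)"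
        by (rule hom_component_mult[OF res_hom[OF ac(1)]])
      then show "hom_component (e c - dg i a) (D i a b * Y b c) = D i a b * Z b c" by (simp add: Z_def)
    qed
    finally show ?thesis by simp
  qed
  moreover have "Z b c \<in> homogeneous_polys (e c - dg (Suc i) b)" for b c by (simp add: Z_def)
  ultimately show ?thesis by (intro exI[of _ Z] conjI ballI)
qed

lemma res_dd: "a \<in> B i \<Longrightarrow> c \<in> B (Suc (Suc i)) \<Longrightarrow> mprod (B (Suc i)) (D i) (D (Suc i)) a c = 0"
proof -
  assume a: "a \<in> B i" and c: "c \<in> B (Suc (Suc i))"
  have "\<exists>y. \<forall>a\<in>B (Suc i). D (Suc i) a c = (\<Sum>b\<in>B (Suc (Suc i)). D (Suc i) a b * y b)"
    by (intro exI ballI) (rule sum_unit_vector(1)[OF res_finite c, symmetric])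
  then have "cycle I B D f (Suc i) (\<lambda>b. D (Suc i) b c)" using res_exact by blast
  then show ?thesis using a by (simp add: cycle_Suc mprod_def)
qed

lemma res_aug_D: "c \<in> B (Suc 0) \<Longrightarrow> (\<Sum>a\<in>B 0. f a * D 0 a c) \<in> I"
proof -
  assume c: "c \<in> B (Suc 0)"
  have "\<exists>y. \<forall>a\<in>B 0. D 0 a c = (\<Sum>b\<in>B (Suc 0). D 0 a b * y b)"
    by (intro exI ballI) (rule sum_unit_vector(1)[OF res_finite c, symmetric])
  then have "cycle I B D f 0 (\<lambda>b. D 0 b c)" using res_exact by blast
  then show ?thesis by (simp add: cycle_0)
qed

lemma res_surj_hom:
  "\<exists>u. (\<forall>b\<in>B 0. u b \<in> homogeneous_polys (- dg 0 b)) \<and> (\<Sum>b\<in>B 0. f b * u b) - 1 \<in> I"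
proof -
  obtain v where v: "(\<Sum>b\<in>B 0. f b * v b) - 1 \<in> I" using res_surj by blast
  have "hom_component 0 ((\<Sum>b\<in>B 0. f b * v b) - 1) = (\<Sum>b\<in>B 0. f b * hom_component (0 - dg 0 b) (v b)) - 1"
    unfolding hom_component_diff hom_component_sum using hom_component_id[OF hom_one] hom_component_mult[OF res_hom_aug, where j = 0]
    by simp
  then have "(\<Sum>b\<in>B 0. f b * hom_component (- dg 0 b) (v b)) - 1 \<in> I"
    using graded_idealD(5)[OF I v, of 0] by simp
  then show ?thesis by (intro exI[of _ "\<lambda>b. hom_component (- dg 0 b) (v b)"]) simp
qed

text \<open>A chain map into a resolution which vanishes on the resolved module is null-homotopic. The homotopy
is built degree by degree: \<open>\<theta>\<^bsub>i+1\<^esub> - h\<^sub>i E\<^sub>i\<close> is a cycle because \<open>D\<^sub>i h\<^sub>i E\<^sub>i = \<theta>\<^sub>i E\<^sub>i\<close>, and \<open>h\<^bsub>i+1\<^esub>\<close>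
is a lift of it. The property \<open>P\<close> in the proof is this last equation, which is what one step has to
hand over to the next.\<close>

lemma res_null_homotopy:
  fixes \<theta> :: "nat \<Rightarrow> 'b \<Rightarrow> 'c \<Rightarrow> ('x, 'k) mpol"
  assumes chain: "\<And>i a c. a \<in> B i \<Longrightarrow> c \<in> C (Suc i) \<Longrightarrow>
      mprod (B (Suc i)) (D i) (\<theta> (Suc i)) a c = mprod (C i) (\<theta> i) (E i) a c"
    and EE: "\<And>i a c. a \<in> C i \<Longrightarrow> c \<in> C (Suc (Suc i)) \<Longrightarrow> mprod (C (Suc i)) (E i) (E (Suc i)) a c = 0"
    and aug: "\<And>c. c \<in> C 0 \<Longrightarrow> (\<Sum>a\<in>B 0. f a * \<theta> 0 a c) \<in> I"
  shows "\<exists>h. \<forall>i. \<forall>a\<in>B i. \<forall>c\<in>C i. \<theta> i a c = mprod (B (Suc i)) (D i) (h i) a c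
      + (case i of 0 \<Rightarrow> 0 | Suc j \<Rightarrow> mprod (C j) (h j) (E j) a c)"
proof -
  define P where "P i h \<longleftrightarrow> (\<forall>a\<in>B i. \<forall>c\<in>C (Suc i). mprod (C i) (\<theta> i) (E i) a c
      = mprod (C i) (mprod (B (Suc i)) (D i) h) (E i) a c)" for i h
  define Q where "Q i h h' \<longleftrightarrow> (\<forall>a\<in>B (Suc i). \<forall>c\<in>C (Suc i). mprod (B (Suc (Suc i))) (D (Suc i)) h' a c
      = \<theta> (Suc i) a c - mprod (C i) h (E i) a c)" for i and h h' :: "'b \<Rightarrow> 'c \<Rightarrow> ('x, 'k) mpol"
  obtain h0 where h0: "\<forall>a\<in>B 0. \<forall>c\<in>C 0. mprod (B (Suc 0)) (D 0) h0 a c = \<theta> 0 a c"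
    using res_lift[of "C 0" 0 "\<theta> 0"] aug by (auto simp: cycle_0)
  have P0: "P 0 h0" unfolding P_def using h0 by (intro ballI mprod_cong) auto
  have step: "\<exists>h'. P (Suc i) h' \<and> Q i h h'" if P: "P i h" for i h
  proof -
    define X where "X = (\<lambda>a c. \<theta> (Suc i) a c - mprod (C i) h (E i) a c)"
    have "mprod (B (Suc i)) (D i) X a c = 0" if "a \<in> B i" "c \<in> C (Suc i)" for a c
      unfolding X_def mprod_diff_right using chain[OF that] P that
      by (simp add: P_def mprod_assoc)
    then have "\<exists>Y. \<forall>a\<in>B (Suc i). \<forall>c\<in>C (Suc i). mprod (B (Suc (Suc i))) (D (Suc i)) Y a c = X a c"
      by (intro res_lift) (simp add: cycle_Suc mprod_def)
    then obtain h' where h': "\<And>a c. a \<in> B (Suc i) \<Longrightarrow> c \<in> C (Suc i) \<Longrightarrow>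
        mprod (B (Suc (Suc i))) (D (Suc i)) h' a c = X a c" by blast
    have "P (Suc i) h'" unfolding P_def
    proof (intro ballI)
      fix a c assume a: "a \<in> B (Suc i)" and c: "c \<in> C (Suc (Suc i))"
      have "mprod (C (Suc i)) (mprod (B (Suc (Suc i))) (D (Suc i)) h') (E (Suc i)) a c
          = mprod (C (Suc i)) X (E (Suc i)) a c" using h' a by (intro mprod_cong) auto
      also have "\<dots> = mprod (C (Suc i)) (\<theta> (Suc i)) (E (Suc i)) a c
          - mprod (C i) h (mprod (C (Suc i)) (E i) (E (Suc i))) a c"
        unfolding X_def mprod_diff_left mprod_assoc ..
      also have "mprod (C i) h (mprod (C (Suc i)) (E i) (E (Suc i))) a c = mprod (C i) h (\<lambda>_ _. 0) a c"
        using EE c by (intro mprod_cong) auto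
      finally show "mprod (C (Suc i)) (\<theta> (Suc i)) (E (Suc i)) a c
          = mprod (C (Suc i)) (mprod (B (Suc (Suc i))) (D (Suc i)) h') (E (Suc i)) a c"
        by (simp add: mprod_def)
    qed
    then show ?thesis using h' by (auto simp: Q_def X_def)
  qed
  have "\<exists>h. \<forall>i. (P i (h i) \<and> (i = 0 \<longrightarrow> h i = h0)) \<and> Q i (h i) (h (Suc i))"
  proof (rule dependent_nat_choice)
    show "\<exists>h. P 0 h \<and> (0 = (0::nat) \<longrightarrow> h = h0)" using P0 by simp
    show "\<exists>h'. (P (Suc i) h' \<and> (Suc i = 0 \<longrightarrow> h' = h0)) \<and> Q i h h'"
      if "P i h \<and> (i = 0 \<longrightarrow> h = h0)" for h i using step[of i h] that by simp
  qed
  then obtain h where h: "\<And>i. P i (h i)" "\<And>i. Q i (h i) (h (Suc i))" "h 0 = h0" by blast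
  show ?thesis
  proof (intro exI[of _ h] allI ballI)
    fix i a c assume ac: "a \<in> B i" "c \<in> C i"
    show "\<theta> i a c = mprod (B (Suc i)) (D i) (h i) a c + (case i of 0 \<Rightarrow> 0 | Suc j \<Rightarrow> mprod (C j) (h j) (E j) a c)"
    proof (cases i)
      case 0
      then show ?thesis using h0 h(3) ac by simp
    next
      case (Suc j)
      then show ?thesis using h(2)[of j] ac by (simp add: Q_def)
    qed
  qed
qed

end

text \<open>The identity of \<open>S/I\<close> lifts to a chain map. In degree \<open>0\<close> the basis element \<open>b\<close> goes to \<open>f b\<close> times a
homogeneous preimage of \<open>1\<close>; afterwards each \<open>\<phi>\<^bsub>i+1\<^esub>\<close> is a homogeneous lift of \<open>\<phi>\<^sub>i D\<^sub>i\<close>.\<close>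

lemma chain_map_exists:
  fixes I :: "('x::finite, 'k::field) mpol set"
  assumes I: "graded_ideal I" and P: "resolves I B dg D f" and Q: "resolves I B' dg' D' f'"
  shows "\<exists>\<phi>. (\<forall>i. \<forall>a\<in>B' i. \<forall>b\<in>B i. \<phi> i a b \<in> homogeneous_polys (dg i b - dg' i a)) \<and>
     (\<forall>i. \<forall>a\<in>B' i. \<forall>c\<in>B (Suc i). mprod (B' (Suc i)) (D' i) (\<phi> (Suc i)) a c = mprod (B i) (\<phi> i) (D i) a c) \<and>
     (\<forall>b\<in>B 0. (\<Sum>a\<in>B' 0. f' a * \<phi> 0 a b) - f b \<in> I)"
proof -
  define R where "R i \<phi> \<longleftrightarrow> (\<forall>a\<in>B' i. \<forall>b\<in>B i. \<phi> a b \<in> homogeneous_polys (dg i b - dg' i a)) \<and>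
     (\<forall>c\<in>B (Suc i). cycle I B' D' f' i (\<lambda>a. mprod (B i) \<phi> (D i) a c))" for i \<phi>
  define S where "S i \<phi> \<phi>' \<longleftrightarrow> (\<forall>a\<in>B' i. \<forall>c\<in>B (Suc i). mprod (B' (Suc i)) (D' i) \<phi>' a c
     = mprod (B i) \<phi> (D i) a c)" for i \<phi> \<phi>'
  obtain u where u: "\<And>a. a \<in> B' 0 \<Longrightarrow> u a \<in> homogeneous_polys (- dg' 0 a)"
    "(\<Sum>a\<in>B' 0. f' a * u a) - 1 \<in> I" using res_surj_hom[OF I Q] by blast
  define \<phi>0 where "\<phi>0 = (\<lambda>a b. u a * f b)"
  have aug: "(\<Sum>a\<in>B' 0. f' a * \<phi>0 a b) - f b \<in> I" for b
  proof -
    have "(\<Sum>a\<in>B' 0. f' a * \<phi>0 a b) - f b = ((\<Sum>a\<in>B' 0. f' a * u a) - 1) * f b"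
      by (simp add: \<phi>0_def sum_distrib_right left_diff_distrib mult.assoc)
    then show ?thesis using graded_idealD(4)[OF I u(2)] by simp
  qed
  have R0: "R 0 \<phi>0" unfolding R_def cycle_0
  proof (intro conjI ballI)
    fix a b assume "a \<in> B' 0" "b \<in> B 0"
    then show "\<phi>0 a b \<in> homogeneous_polys (dg 0 b - dg' 0 a)"
      unfolding \<phi>0_def using u(1) res_hom_aug[OF I P] by (intro hom_mult') auto
  next
    fix c assume c: "c \<in> B (Suc 0)"
    have "(\<Sum>a\<in>B' 0. f' a * mprod (B 0) \<phi>0 (D 0) a c) = (\<Sum>a\<in>B' 0. f' a * u a) * (\<Sum>b\<in>B 0. f b * D 0 b c)"
      unfolding sum_product by (simp add: mprod_def \<phi>0_def sum_distrib_left mult_ac)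
    then show "(\<Sum>a\<in>B' 0. f' a * mprod (B 0) \<phi>0 (D 0) a c) \<in> I"
      using graded_idealD(3)[OF I res_aug_D[OF I P c]] by simp
  qed
  have step: "\<exists>\<phi>'. R (Suc i) \<phi>' \<and> S i \<phi> \<phi>'" if R: "R i \<phi>" for i \<phi>
  proof -
    have "\<exists>\<phi>'. (\<forall>a\<in>B' i. \<forall>c\<in>B (Suc i). mprod (B' (Suc i)) (D' i) \<phi>' a c = mprod (B i) \<phi> (D i) a c) \<and>
       (\<forall>b\<in>B' (Suc i). \<forall>c\<in>B (Suc i). \<phi>' b c \<in> homogeneous_polys (dg (Suc i) c - dg' (Suc i) b))"
    proof (rule res_lift_hom[OF I Q])
      show "cycle I B' D' f' i (\<lambda>a. mprod (B i) \<phi> (D i) a c)" if "c \<in> B (Suc i)" for c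
        using R that by (simp add: R_def)
      show "mprod (B i) \<phi> (D i) a c \<in> homogeneous_polys (dg (Suc i) c - dg' i a)"
        if "a \<in> B' i" "c \<in> B (Suc i)" for a c
        using R that res_hom[OF I P] by (intro hom_mprod[where e = "dg i"]) (auto simp: R_def)
    qed
    then obtain \<phi>' where S: "S i \<phi> \<phi>'" and hom:
      "\<forall>b\<in>B' (Suc i). \<forall>c\<in>B (Suc i). \<phi>' b c \<in> homogeneous_polys (dg (Suc i) c - dg' (Suc i) b)"
      by (auto simp: S_def)
    have "mprod (B' (Suc i)) (D' i) (mprod (B (Suc i)) \<phi>' (D (Suc i))) a c = 0"
      if a: "a \<in> B' i" and c: "c \<in> B (Suc (Suc i))" for a c
    proof -
      have "mprod (B' (Suc i)) (D' i) (mprod (B (Suc i)) \<phi>' (D (Suc i))) a c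
          = mprod (B (Suc i)) (mprod (B' (Suc i)) (D' i) \<phi>') (D (Suc i)) a c" by (simp add: mprod_assoc)
      also have "\<dots> = mprod (B (Suc i)) (mprod (B i) \<phi> (D i)) (D (Suc i)) a c"
        using S a by (intro mprod_cong) (auto simp: S_def)
      also have "\<dots> = mprod (B i) \<phi> (mprod (B (Suc i)) (D i) (D (Suc i))) a c" by (simp add: mprod_assoc)
      also have "\<dots> = mprod (B i) \<phi> (\<lambda>_ _. 0) a c"
        using res_dd[OF I P _ c] by (intro mprod_cong) auto
      finally show ?thesis by (simp add: mprod_def)
    qed
    then have "R (Suc i) \<phi>'" using hom by (auto simp: R_def cycle_Suc mprod_def)
    then show ?thesis using S by blast
  qed
  have "\<exists>\<phi>. \<forall>i. (R i (\<phi> i) \<and> (i = 0 \<longrightarrow> \<phi> i = \<phi>0)) \<and> S i (\<phi> i) (\<phi> (Suc i))"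
  proof (rule dependent_nat_choice)
    show "\<exists>\<phi>. R 0 \<phi> \<and> (0 = (0::nat) \<longrightarrow> \<phi> = \<phi>0)" using R0 by simp
    show "\<exists>\<phi>'. (R (Suc i) \<phi>' \<and> (Suc i = 0 \<longrightarrow> \<phi>' = \<phi>0)) \<and> S i \<phi> \<phi>'"
      if "R i \<phi> \<and> (i = 0 \<longrightarrow> \<phi> = \<phi>0)" for \<phi> i using step[of i \<phi>] that by simp
  qed
  then obtain \<phi> where "\<And>i. R i (\<phi> i)" "\<And>i. S i (\<phi> i) (\<phi> (Suc i))" "\<phi> 0 = \<phi>0" by blast
  then show ?thesis using aug unfolding R_def S_def by blast
qed

text \<open>Passing from one resolution of \<open>S/I\<close> to another one and back is homotopic to the identity, since
the difference vanishes on \<open>S/I\<close>. The two theorems below read this identity modulo the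
variables.\<close>

lemma round_trip_homotopy:
  fixes I :: "('x::finite, 'k::field) mpol set" and B :: "nat \<Rightarrow> 'b set" and B' :: "nat \<Rightarrow> 'c set"
  assumes I: "graded_ideal I" and P: "resolves I B dg D f" and Q: "resolves I B' dg' D' f'"
  obtains \<phi> \<psi> h where
    "\<And>i a b. a \<in> B' i \<Longrightarrow> b \<in> B i \<Longrightarrow> \<phi> i a b \<in> homogeneous_polys (dg i b - dg' i a)"
    "\<And>i b c. b \<in> B i \<Longrightarrow> c \<in> B' i \<Longrightarrow> \<psi> i b c \<in> homogeneous_polys (dg' i c - dg i b)"
    "\<And>i a c. a \<in> B' i \<Longrightarrow> c \<in> B' i \<Longrightarrow> mprod (B i) (\<phi> i) (\<psi> i) a c - (if a = c then 1 else 0)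
        = mprod (B' (Suc i)) (D' i) (h i) a c + (case i of 0 \<Rightarrow> 0 | Suc j \<Rightarrow> mprod (B' j) (h j) (D' j) a c)"
proof -
  obtain \<phi> where \<phi>: "\<And>i a b. a \<in> B' i \<Longrightarrow> b \<in> B i \<Longrightarrow> \<phi> i a b \<in> homogeneous_polys (dg i b - dg' i a)"
    "\<And>i a c. a \<in> B' i \<Longrightarrow> c \<in> B (Suc i) \<Longrightarrow> mprod (B' (Suc i)) (D' i) (\<phi> (Suc i)) a c = mprod (B i) (\<phi> i) (D i) a c"
    "\<And>b. b \<in> B 0 \<Longrightarrow> (\<Sum>a\<in>B' 0. f' a * \<phi> 0 a b) - f b \<in> I"
    using chain_map_exists[OF I P Q] by blast
  obtain \<psi> where \<psi>: "\<And>i a b. a \<in> B i \<Longrightarrow> b \<in> B' i \<Longrightarrow> \<psi> i a b \<in> homogeneous_polys (dg' i b - dg i a)"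
    "\<And>i a c. a \<in> B i \<Longrightarrow> c \<in> B' (Suc i) \<Longrightarrow> mprod (B (Suc i)) (D i) (\<psi> (Suc i)) a c = mprod (B' i) (\<psi> i) (D' i) a c"
    "\<And>b. b \<in> B' 0 \<Longrightarrow> (\<Sum>a\<in>B 0. f a * \<psi> 0 a b) - f' b \<in> I"
    using chain_map_exists[OF I Q P] by blast
  define one :: "'c \<Rightarrow> 'c \<Rightarrow> ('x, 'k) mpol" where "one a c = (if a = c then 1 else 0)" for a c
  define \<theta> where "\<theta> i = (\<lambda>a c. mprod (B i) (\<phi> i) (\<psi> i) a c - one a c)" for i
  note fin = res_finite[OF I Q]
  have one_right: "mprod (B' i) X one a c = X a c" if "c \<in> B' i" for X a c i
    unfolding mprod_def one_def by (rule sum_unit_vector(1)[OF fin that])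
  have one_left: "mprod (B' i) one X a c = X a c" if "a \<in> B' i" for X a c i
    unfolding mprod_def one_def by (rule sum_unit_vector(2)[OF fin that])
  have "\<exists>h. \<forall>i. \<forall>a\<in>B' i. \<forall>c\<in>B' i. \<theta> i a c = mprod (B' (Suc i)) (D' i) (h i) a c
      + (case i of 0 \<Rightarrow> 0 | Suc j \<Rightarrow> mprod (B' j) (h j) (D' j) a c)"
  proof (rule res_null_homotopy[OF I Q])
    fix i a c assume a: "a \<in> B' i" and c: "c \<in> B' (Suc i)"
    have "mprod (B' (Suc i)) (D' i) (mprod (B (Suc i)) (\<phi> (Suc i)) (\<psi> (Suc i))) a c
        = mprod (B (Suc i)) (mprod (B' (Suc i)) (D' i) (\<phi> (Suc i))) (\<psi> (Suc i)) a c"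
      by (simp add: mprod_assoc)
    also have "\<dots> = mprod (B (Suc i)) (mprod (B i) (\<phi> i) (D i)) (\<psi> (Suc i)) a c"
      using \<phi>(2) a by (intro mprod_cong) auto
    also have "\<dots> = mprod (B i) (\<phi> i) (mprod (B (Suc i)) (D i) (\<psi> (Suc i))) a c"
      by (simp add: mprod_assoc)
    also have "\<dots> = mprod (B i) (\<phi> i) (mprod (B' i) (\<psi> i) (D' i)) a c"
      using \<psi>(2) c by (intro mprod_cong) auto
    also have "\<dots> = mprod (B' i) (mprod (B i) (\<phi> i) (\<psi> i)) (D' i) a c"
      by (simp add: mprod_assoc)
    finally show "mprod (B' (Suc i)) (D' i) (\<theta> (Suc i)) a c = mprod (B' i) (\<theta> i) (D' i) a c"
      unfolding \<theta>_def mprod_diff_left mprod_diff_right one_left[OF a] one_right[OF c] by simp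
  next
    fix i a c assume "a \<in> B' i" "c \<in> B' (Suc (Suc i))"
    then show "mprod (B' (Suc i)) (D' i) (D' (Suc i)) a c = 0" by (rule res_dd[OF I Q])
  next
    fix c assume c: "c \<in> B' 0"
    have "(\<Sum>a\<in>B' 0. f' a * \<theta> 0 a c)
        = mprod (B' 0) (\<lambda>_. f') (mprod (B 0) (\<phi> 0) (\<psi> 0)) () c - mprod (B' 0) (\<lambda>_. f') one () c"
      unfolding \<theta>_def mprod_diff_right[symmetric] by (simp add: mprod_def)
    also have "\<dots> = mprod (B 0) (mprod (B' 0) (\<lambda>_. f') (\<phi> 0)) (\<psi> 0) () c - f' c"
      using one_right[OF c] by (simp add: mprod_assoc)
    also have "\<dots> = mprod (B 0) (\<lambda>u b. mprod (B' 0) (\<lambda>_. f') (\<phi> 0) u b - f b) (\<psi> 0) () c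
         + ((\<Sum>a\<in>B 0. f a * \<psi> 0 a c) - f' c)"
      unfolding mprod_diff_left by (simp add: mprod_def)
    also have "\<dots> \<in> I"
    proof (rule graded_idealD(2)[OF I _ \<psi>(3)[OF c]])
      show "mprod (B 0) (\<lambda>u b. mprod (B' 0) (\<lambda>_. f') (\<phi> 0) u b - f b) (\<psi> 0) () c \<in> I"
        unfolding mprod_def using \<phi>(3) by (intro graded_ideal_sum[OF I] graded_idealD(4)[OF I]) auto
    qed
    finally show "(\<Sum>a\<in>B' 0. f' a * \<theta> 0 a c) \<in> I" .
  qed
  then obtain h where h: "\<forall>i. \<forall>a\<in>B' i. \<forall>c\<in>B' i. \<theta> i a c = mprod (B' (Suc i)) (D' i) (h i) a c
      + (case i of 0 \<Rightarrow> 0 | Suc j \<Rightarrow> mprod (B' j) (h j) (D' j) a c)" ..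
  show ?thesis by (rule that[OF \<phi>(1) \<psi>(1) h[unfolded \<theta>_def one_def, rule_format]])
qed

lemma lookup_mprod_0:
  fixes X :: "'a \<Rightarrow> 'b \<Rightarrow> ('x, 'k::comm_ring_1) mpol"
  shows "lk (mprod B X Y a c) 0 = (\<Sum>b\<in>B. lk (X a b) 0 * lk (Y b c) 0)"
  by (simp add: mprod_def lookup_sum lookup_times_zero)

text \<open>If the second resolution is minimal, the homotopy terms have constant term \<open>0\<close>, so that the diagonal
entry of \<open>\<phi>\<psi>\<close> at \<open>c\<close> has constant term \<open>1\<close>. But every entry of \<open>\<phi>\<close> in the row of \<open>c\<close> is homogeneous of
degree \<open>dg i b - dg' i c\<close>, and it has constant term \<open>0\<close> unless this degree is \<open>0\<close>.\<close>

theorem minimal_resolution_is_smallest: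
  fixes I :: "('x::finite, 'k::field) mpol set"
  assumes I: "graded_ideal I" and P: "resolves I B dg D f" and Q: "resolves I B' dg' D' f'"
    and min: "minimal_maps B' D'" and c: "c \<in> B' i"
  shows "\<exists>b\<in>B i. dg i b = dg' i c"
proof (rule ccontr)
  assume neg: "\<not> (\<exists>b\<in>B i. dg i b = dg' i c)"
  show False
  proof (rule round_trip_homotopy[OF I P Q])
    fix \<phi> \<psi> h assume
      hom: "\<And>i a b. a \<in> B' i \<Longrightarrow> b \<in> B i \<Longrightarrow> \<phi> i a b \<in> homogeneous_polys (dg i b - dg' i a)"
        "\<And>i b c. b \<in> B i \<Longrightarrow> c \<in> B' i \<Longrightarrow> \<psi> i b c \<in> homogeneous_polys (dg' i c - dg i b)" and
      eq: "\<And>i a c. a \<in> B' i \<Longrightarrow> c \<in> B' i \<Longrightarrow> mprod (B i) (\<phi> i) (\<psi> i) a c - (if a = c then 1 else 0)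
          = mprod (B' (Suc i)) (D' i) (h i) a c + (case i of 0 \<Rightarrow> 0 | Suc j \<Rightarrow> mprod (B' j) (h j) (D' j) a c)"
    have "lk (\<phi> i c b) 0 = 0" if "b \<in> B i" for b
      by (rule hom_const_term[OF hom(1)[OF c that]]) (use neg that in auto)
    then have 1: "lk (mprod (B i) (\<phi> i) (\<psi> i) c c) 0 = 0"
      unfolding lookup_mprod_0 by (intro sum.neutral ballI) simp
    have 2: "lk (mprod (B' (Suc i)) (D' i) (h i) c c) 0 = 0"
      unfolding lookup_mprod_0 using min c by (intro sum.neutral ballI) (simp add: minimal_maps_def)
    have 3: "lk (case i of 0 \<Rightarrow> 0 | Suc j \<Rightarrow> mprod (B' j) (h j) (D' j) c c) 0 = 0"
    proof (cases i)
      case (Suc j)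
      then show ?thesis unfolding Suc nat.case lookup_mprod_0
        using min c[unfolded Suc] by (intro sum.neutral ballI) (simp add: minimal_maps_def)
    qed simp
    have "lk (mprod (B i) (\<phi> i) (\<psi> i) c c) 0 - lk (if c = c then 1 else 0 :: ('x, 'k) mpol) 0
        = lk (mprod (B' (Suc i)) (D' i) (h i) c c) 0
          + lk (case i of 0 \<Rightarrow> 0 | Suc j \<Rightarrow> mprod (B' j) (h j) (D' j) c c) 0"
      unfolding lookup_minus[symmetric] lookup_add[symmetric] eq[OF c c] ..
    then show False unfolding 1 2 3 by simp
  qed
qed

text \<open>If the first resolution has no basis element in the position of \<open>c\<close>, then \<open>\<phi>\<psi>\<close> has constant terms
\<open>0\<close> in the column of \<open>c\<close>. If moreover the basis element \<open>c\<close> of the second resolution is a cycle modulo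
the variables, the homotopy identity expresses it as a boundary modulo the variables.\<close>

theorem cycle_mod_maximal_is_boundary:
  fixes I :: "('x::finite, 'k::field) mpol set"
  assumes I: "graded_ideal I" and P: "resolves I B dg D f" and Q: "resolves I B' dg' D' f'"
    and none: "\<And>b. b \<in> B i \<Longrightarrow> dg i b \<noteq> dg' i c" and c: "c \<in> B' i"
    and cyc: "\<And>j a. i = Suc j \<Longrightarrow> a \<in> B' j \<Longrightarrow> lk (D' j a c) 0 = 0"
  shows "\<exists>z. \<forall>a\<in>B' i. (if a = c then 1 else 0) = (\<Sum>b\<in>B' (Suc i). lk (D' i a b) 0 * z b)"
proof -
  show ?thesis
  proof (rule round_trip_homotopy[OF I P Q])
    fix \<phi> \<psi> h assume
      hom: "\<And>i a b. a \<in> B' i \<Longrightarrow> b \<in> B i \<Longrightarrow> \<phi> i a b \<in> homogeneous_polys (dg i b - dg' i a)"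
        "\<And>i b c. b \<in> B i \<Longrightarrow> c \<in> B' i \<Longrightarrow> \<psi> i b c \<in> homogeneous_polys (dg' i c - dg i b)" and
      eq: "\<And>i a c. a \<in> B' i \<Longrightarrow> c \<in> B' i \<Longrightarrow> mprod (B i) (\<phi> i) (\<psi> i) a c - (if a = c then 1 else 0)
          = mprod (B' (Suc i)) (D' i) (h i) a c + (case i of 0 \<Rightarrow> 0 | Suc j \<Rightarrow> mprod (B' j) (h j) (D' j) a c)"
    have "lk (\<psi> i b c) 0 = 0" if "b \<in> B i" for b
      by (rule hom_const_term[OF hom(2)[OF that c]]) (use none[OF that] in simp)
    then have 1: "lk (mprod (B i) (\<phi> i) (\<psi> i) a c) 0 = 0" for a
      unfolding lookup_mprod_0 by (intro sum.neutral ballI) simp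
    have 3: "lk (case i of 0 \<Rightarrow> 0 | Suc j \<Rightarrow> mprod (B' j) (h j) (D' j) a c) 0 = 0" for a
    proof (cases i)
      case (Suc j)
      then show ?thesis unfolding Suc nat.case lookup_mprod_0
        using cyc[OF Suc] by (intro sum.neutral ballI) simp
    qed simp
    have "(if a = c then 1 else 0) = (\<Sum>b\<in>B' (Suc i). lk (D' i a b) 0 * (- lk (h i b c) 0))"
      if "a \<in> B' i" for a
    proof -
      have "lk (mprod (B i) (\<phi> i) (\<psi> i) a c) 0 - lk (if a = c then 1 else 0 :: ('x, 'k) mpol) 0
          = lk (mprod (B' (Suc i)) (D' i) (h i) a c) 0
            + lk (case i of 0 \<Rightarrow> 0 | Suc j \<Rightarrow> mprod (B' j) (h j) (D' j) a c) 0"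
        unfolding lookup_minus[symmetric] lookup_add[symmetric] eq[OF that c] ..
      then have "- (if a = c then 1 else 0) = lk (mprod (B' (Suc i)) (D' i) (h i) a c) 0"
        unfolding 1 3 by (simp split: if_splits)
      then have "(if a = c then 1 else 0) = - lk (mprod (B' (Suc i)) (D' i) (h i) a c) 0"
        by (metis add.inverse_inverse)
      then show ?thesis by (simp add: lookup_mprod_0 sum_negf del: neg_equal_iff_equal)
    qed
    then show ?thesis by (intro exI[of _ "\<lambda>b. - lk (h i b c) 0"] ballI)
  qed
qed

section \<open>Cancelling unit entries\<close>

text \<open>If the matrix \<open>D k\<close> has a unit in row \<open>a\<close> and column \<open>b\<close>, the basis element \<open>b\<close> and its boundary span
a contractible direct summand, which can be split off. The remaining block of \<open>D k\<close> is replaced by its Schur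
complement with respect to the unit, whose inverse is \<open>w\<close>; the neighbouring matrices only lose a row
or a column.\<close>

definition trim_basis :: "(nat \<Rightarrow> 'b set) \<Rightarrow> nat \<Rightarrow> 'b \<Rightarrow> 'b \<Rightarrow> nat \<Rightarrow> 'b set" where
  "trim_basis B k a b i = B i - (if i = k then {a} else if i = Suc k then {b} else {})"

definition trim_maps :: "(nat \<Rightarrow> 'b \<Rightarrow> 'b \<Rightarrow> 'r::comm_ring_1) \<Rightarrow> nat \<Rightarrow> 'b \<Rightarrow> 'b \<Rightarrow> 'r
    \<Rightarrow> nat \<Rightarrow> 'b \<Rightarrow> 'b \<Rightarrow> 'r" where
  "trim_maps D k a b w i x y = (if i = k then D k x y - D k x b * w * D k a y else D i x y)"

text \<open>A vector \<open>v\<close> on the basis without \<open>b\<close> has exactly one extension \<open>\<iota> v\<close> to \<open>b\<close> which \<open>D k\<close> maps to a vector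
with coordinate \<open>0\<close> at \<open>a\<close>, and on it \<open>D k\<close> agrees with the Schur complement. Thus kernels and images
of the new maps in degrees \<open>k\<close> and \<open>Suc k\<close> are those of the old ones, seen through \<open>\<iota>\<close>. In degree
\<open>Suc (Suc k)\<close> the lost row imposes no condition of its own, and one degree below \<open>k\<close> the lost column
does not shrink the image, as the boundary of \<open>b\<close> clears the coordinate at \<open>a\<close>.\<close>

lemma resolves_trim:
  fixes I :: "('x::finite, 'k::field) mpol set" and B :: "nat \<Rightarrow> 'b set"
  assumes I: "graded_ideal I" and res: "resolves I B dg D f"
    and a: "a \<in> B k" and b: "b \<in> B (Suc k)" and w: "w * D k a b = 1"
    and w_hom: "w \<in> homogeneous_polys 0" and dg_eq: "dg (Suc k) b = dg k a"
  shows "resolves I (trim_basis B k a b) dg (trim_maps D k a b w) f"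
proof -
  let ?B = "trim_basis B k a b" and ?D = "trim_maps D k a b w"
  note fin = res_finite[OF I res] and exact = res_exact[OF I res]
  have B_same: "?B i = B i" if "i \<noteq> k" "i \<noteq> Suc k" for i using that by (simp add: trim_basis_def)
  have B_k: "?B k = B k - {a}" and B_Sk: "?B (Suc k) = B (Suc k) - {b}" by (simp_all add: trim_basis_def)
  have D_same: "?D i = D i" if "i \<noteq> k" for i using that by (simp add: trim_maps_def fun_eq_iff)
  have D_k: "?D k x y = D k x y - D k x b * w * D k a y" for x y by (simp add: trim_maps_def)
  define S where "S v = (\<Sum>z\<in>?B (Suc k). D k a z * v z)" for v
  define \<iota> where "\<iota> v = v(b := - (w * S v))" for v
  have \<iota>_off: "\<iota> v x = v x" if "x \<noteq> b" for v x using that by (simp add: \<iota>_def)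
  have \<iota>_at: "\<iota> v b = - (w * S v)" for v by (simp add: \<iota>_def)
  have split: "(\<Sum>z\<in>B (Suc k). D k x z * y z) = D k x b * y b + (\<Sum>z\<in>?B (Suc k). D k x z * y z)" for x y
    unfolding B_Sk by (rule sum.remove[OF fin b])
  have S_cong: "S v = S v'" if "\<And>z. z \<in> ?B (Suc k) \<Longrightarrow> v z = v' z" for v v'
    unfolding S_def using that by (intro sum.cong) auto
  have app_\<iota>: "(\<Sum>z\<in>B (Suc k). D k x z * \<iota> v z) = (\<Sum>z\<in>?B (Suc k). ?D k x z * v z)" for x v
  proof -
    have "(\<Sum>z\<in>?B (Suc k). D k x z * \<iota> v z) = (\<Sum>z\<in>?B (Suc k). D k x z * v z)"
      by (intro sum.cong refl) (simp add: \<iota>_off B_Sk)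
    moreover have "(\<Sum>z\<in>?B (Suc k). ?D k x z * v z)
        = (\<Sum>z\<in>?B (Suc k). D k x z * v z) - D k x b * w * S v"
      by (simp add: D_k left_diff_distrib sum_subtractf S_def sum_distrib_left mult.assoc)
    ultimately show ?thesis unfolding split \<iota>_at by (simp add: mult.assoc)
  qed
  have app_\<iota>_a: "(\<Sum>z\<in>B (Suc k). D k a z * \<iota> v z) = 0" for v
  proof -
    have "?D k a z = 0" for z using w by (simp add: D_k mult.commute)
    then show ?thesis unfolding app_\<iota> by simp
  qed
  have \<iota>_fix: "y z = \<iota> y z" if y: "(\<Sum>z\<in>B (Suc k). D k a z * y z) = 0" for y z
  proof (cases "z = b")
    case True
    have "D k a b * y b = - S y" using y unfolding split S_def by (simp add: eq_neg_iff_add_eq_0)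
    then have "w * (D k a b * y b) = w * - S y" by (rule arg_cong)
    then have "y b = - (w * S y)" using w by (simp add: mult.assoc[symmetric])
    then show ?thesis using True \<iota>_at by simp
  qed (simp add: \<iota>_off)
  have sum_upd: "(\<Sum>z\<in>B k. g z * (v(a := 0)) z) = (\<Sum>z\<in>B k - {a}. g z * v z)"
    for g v :: "'b \<Rightarrow> ('x, 'k) mpol"
  proof -
    have "(\<Sum>z\<in>B k. g z * (v(a := 0)) z) = g a * 0 + (\<Sum>z\<in>B k - {a}. g z * (v(a := 0)) z)"
      using sum.remove[OF fin a, of "\<lambda>z. g z * (v(a := 0)) z"] by simp
    also have "(\<Sum>z\<in>B k - {a}. g z * (v(a := 0)) z) = (\<Sum>z\<in>B k - {a}. g z * v z)"
      by (intro sum.cong) auto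
    finally show ?thesis by simp
  qed
  \<comment> \<open>Subtracting a multiple of the boundary of \<open>b\<close> makes the coordinate at \<open>a\<close> vanish.\<close>
  define clear where "clear v = (\<lambda>z. v z - w * v a * D k z b)" for v
  have clear_a: "clear v a = 0" for v
  proof -
    have "w * v a * D k a b = (w * D k a b) * v a" by (simp only: mult_ac)
    then show ?thesis using w by (simp add: clear_def)
  qed
  have clear_sum: "(\<Sum>z\<in>B k - {a}. g z * clear v z)
      = (\<Sum>z\<in>B k. g z * v z) - w * v a * (\<Sum>z\<in>B k. g z * D k z b)" for g v
  proof -
    have "(\<Sum>z\<in>B k - {a}. g z * clear v z) = (\<Sum>z\<in>B k. g z * clear v z)"
      using sum.remove[OF fin a, of "\<lambda>z. g z * clear v z"] clear_a by simp
    then show ?thesis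
      by (simp add: clear_def right_diff_distrib sum_subtractf sum_distrib_left mult_ac)
  qed
  have image: "cycle I B D f i (\<lambda>x. \<Sum>z\<in>B (Suc i). D i x z * y z)" for i y
    unfolding exact by (rule exI[of _ y]) simp
  have exact': "cycle I ?B ?D f i v \<longleftrightarrow> (\<exists>y. \<forall>x\<in>?B i. v x = (\<Sum>z\<in>?B (Suc i). ?D i x z * y z))" for i v
  proof -
    consider "i = k" | "i = Suc k" | "i = Suc (Suc k)" | "Suc i = k"
      | "i \<noteq> k" "i \<noteq> Suc k" "i \<noteq> Suc (Suc k)" "Suc i \<noteq> k" by blast
    then show ?thesis
    proof cases
      case 1
      have "cycle I ?B ?D f k v \<longleftrightarrow> cycle I B D f k (v(a := 0))"
      proof (cases k)
        case 0
        then show ?thesis using sum_upd[of f v] B_k by (simp add: cycle_0)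
      next
        case (Suc j)
        have "j \<noteq> k" "j \<noteq> Suc k" using Suc by simp_all
        then have j: "?B j = B j" "?D j = D j" using B_same D_same by simp_all
        have "(\<Sum>z\<in>?B k. D j x z * v z) = (\<Sum>z\<in>B k. D j x z * (v(a := 0)) z)" for x
          unfolding sum_upd B_k ..
        then show ?thesis unfolding Suc cycle_Suc j[unfolded Suc] by simp
      qed
      also have "\<dots> \<longleftrightarrow> (\<exists>y. \<forall>x\<in>?B k. v x = (\<Sum>z\<in>?B (Suc k). ?D k x z * y z))"
      proof
        assume "cycle I B D f k (v(a := 0))"
        then obtain y where y: "\<forall>x\<in>B k. (v(a := 0)) x = (\<Sum>z\<in>B (Suc k). D k x z * y z)"
          unfolding exact ..
        have y_a: "(\<Sum>z\<in>B (Suc k). D k a z * y z) = 0" using y[rule_format, OF a] by simp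
        have "v x = (\<Sum>z\<in>?B (Suc k). ?D k x z * y z)" if x: "x \<in> ?B k" for x
        proof -
          have "v x = (\<Sum>z\<in>B (Suc k). D k x z * y z)" using y[rule_format, of x] x by (auto simp: B_k)
          also have "\<dots> = (\<Sum>z\<in>B (Suc k). D k x z * \<iota> y z)" 
            by (intro sum.cong refl arg_cong[where f = "(*) _"] \<iota>_fix[OF y_a])
          finally show ?thesis unfolding app_\<iota> .
        qed
        then show "\<exists>y. \<forall>x\<in>?B k. v x = (\<Sum>z\<in>?B (Suc k). ?D k x z * y z)"
          by (intro exI[of _ y] ballI)
      next
        assume "\<exists>y. \<forall>x\<in>?B k. v x = (\<Sum>z\<in>?B (Suc k). ?D k x z * y z)"
        then obtain y where y: "\<forall>x\<in>?B k. v x = (\<Sum>z\<in>?B (Suc k). ?D k x z * y z)" ..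
        have "(v(a := 0)) x = (\<Sum>z\<in>B (Suc k). D k x z * \<iota> y z)" if x: "x \<in> B k" for x
        proof (cases "x = a")
          case True
          then show ?thesis using app_\<iota>_a by simp
        next
          case False
          then show ?thesis using y[rule_format, of x] x unfolding app_\<iota> by (simp add: B_k)
        qed
        then show "cycle I B D f k (v(a := 0))" unfolding exact by (intro exI[of _ "\<iota> y"] ballI)
      qed
      finally show ?thesis using 1 by simp
    next
      case 2
      have "cycle I ?B ?D f (Suc k) v \<longleftrightarrow> (\<forall>x\<in>B k - {a}. (\<Sum>z\<in>B (Suc k). D k x z * \<iota> v z) = 0)"
        unfolding cycle_Suc app_\<iota> B_k ..
      also have "\<dots> \<longleftrightarrow> cycle I B D f (Suc k) (\<iota> v)"
        unfolding cycle_Suc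
      proof (intro iffI ballI)
        fix x assume 0: "\<forall>x\<in>B k - {a}. (\<Sum>z\<in>B (Suc k). D k x z * \<iota> v z) = 0" and x: "x \<in> B k"
        show "(\<Sum>z\<in>B (Suc k). D k x z * \<iota> v z) = 0"
        proof (cases "x = a")
          case True
          show ?thesis unfolding True by (rule app_\<iota>_a)
        qed (use 0 x in simp)
      qed simp
      also have "\<dots> \<longleftrightarrow> (\<exists>y. \<forall>x\<in>?B (Suc k). v x = (\<Sum>z\<in>?B (Suc (Suc k)). ?D (Suc k) x z * y z))"
      proof
        assume "cycle I B D f (Suc k) (\<iota> v)"
        then obtain y where y: "\<forall>x\<in>B (Suc k). \<iota> v x = (\<Sum>z\<in>B (Suc (Suc k)). D (Suc k) x z * y z)"
          unfolding exact ..
        have "v x = (\<Sum>z\<in>?B (Suc (Suc k)). ?D (Suc k) x z * y z)" if "x \<in> ?B (Suc k)" for x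
          using that y[rule_format, of x] \<iota>_off[of x v] by (simp add: B_Sk B_same D_same)
        then show "\<exists>y. \<forall>x\<in>?B (Suc k). v x = (\<Sum>z\<in>?B (Suc (Suc k)). ?D (Suc k) x z * y z)"
          by (intro exI[of _ y] ballI)
      next
        assume "\<exists>y. \<forall>x\<in>?B (Suc k). v x = (\<Sum>z\<in>?B (Suc (Suc k)). ?D (Suc k) x z * y z)"
        then obtain y where y: "\<forall>x\<in>?B (Suc k). v x = (\<Sum>z\<in>?B (Suc (Suc k)). ?D (Suc k) x z * y z)" ..
        define u where "u = (\<lambda>x. \<Sum>z\<in>B (Suc (Suc k)). D (Suc k) x z * y z)"
        have u: "v x = u x" if "x \<in> ?B (Suc k)" for x
          using y[rule_format, OF that] by (simp add: u_def B_same D_same)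
        have "(\<Sum>z\<in>B (Suc k). D k a z * u z) = 0"
          unfolding u_def by (rule image[of "Suc k" y, unfolded cycle_Suc, rule_format, OF a])
        then have "u b = - (w * S u)" using \<iota>_fix[of u b] \<iota>_at by simp
        also have "S u = S v" using u by (intro S_cong) simp
        finally have "\<iota> v b = u b" using \<iota>_at by simp
        then have "\<iota> v x = u x" if "x \<in> B (Suc k)" for x
          using that u[of x] \<iota>_off[of x v] by (cases "x = b") (simp_all add: B_Sk)
        then have "\<forall>x\<in>B (Suc k). \<iota> v x = u x" by (rule ballI)
        then show "cycle I B D f (Suc k) (\<iota> v)" unfolding exact u_def by (rule exI[of _ y])
      qed
      finally show ?thesis using 2 by simp
    next
      case 3
      have "cycle I ?B ?D f i v \<longleftrightarrow> cycle I B D f i v"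
      proof
        assume c: "cycle I ?B ?D f i v"
        define u where "u = (\<lambda>x. \<Sum>z\<in>B (Suc (Suc k)). D (Suc k) x z * v z)"
        have u: "u x = 0" if "x \<in> ?B (Suc k)" for x
          using c that unfolding 3 cycle_Suc u_def by (simp add: B_same D_same)
        have "(\<Sum>z\<in>B (Suc k). D k a z * u z) = 0"
          unfolding u_def by (rule image[of "Suc k" v, unfolded cycle_Suc, rule_format, OF a])
        then have "u b = - (w * S u)" using \<iota>_fix[of u b] \<iota>_at by simp
        also have "S u = 0" unfolding S_def using u by (intro sum.neutral) simp
        finally have "u b = 0" by simp
        then have "u x = 0" if "x \<in> B (Suc k)" for x
          using that u[of x] by (cases "x = b") (simp_all add: B_Sk)
        then show "cycle I B D f i v" unfolding 3 cycle_Suc u_def by (rule ballI)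
      next
        assume "cycle I B D f i v"
        then show "cycle I ?B ?D f i v" unfolding 3 cycle_Suc by (simp add: B_same D_same B_Sk)
      qed
      then show ?thesis unfolding exact 3 by (simp add: B_same D_same)
    next
      case 4
      have "cycle I ?B ?D f i v \<longleftrightarrow> cycle I B D f i v"
        using 4 by (cases i) (auto simp: cycle_0 cycle_Suc B_same D_same)
      also have "\<dots> \<longleftrightarrow> (\<exists>y. \<forall>x\<in>?B i. v x = (\<Sum>z\<in>?B (Suc i). ?D i x z * y z))"
      proof
        assume "cycle I B D f i v"
        then obtain y where y: "\<forall>x\<in>B i. v x = (\<Sum>z\<in>B (Suc i). D i x z * y z)" unfolding exact ..
        have "v x = (\<Sum>z\<in>B k - {a}. D i x z * clear y z)" if x: "x \<in> B i" for x
        proof -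
          have "(\<Sum>z\<in>B k. D i x z * D k z b) = 0"
            using res_dd[OF I res x, of b] b 4 by (simp add: mprod_def)
          then show ?thesis unfolding clear_sum using y x 4 by simp
        qed
        then have "\<forall>x\<in>?B i. v x = (\<Sum>z\<in>?B (Suc i). ?D i x z * clear y z)"
          using 4 B_k by (auto simp: B_same D_same)
        then show "\<exists>y. \<forall>x\<in>?B i. v x = (\<Sum>z\<in>?B (Suc i). ?D i x z * y z)"
          by (rule exI[of _ "clear y"])
      next
        assume "\<exists>y. \<forall>x\<in>?B i. v x = (\<Sum>z\<in>?B (Suc i). ?D i x z * y z)"
        then obtain y where y: "\<forall>x\<in>?B i. v x = (\<Sum>z\<in>?B (Suc i). ?D i x z * y z)" ..
        have "\<forall>x\<in>B i. v x = (\<Sum>z\<in>B (Suc i). D i x z * (y(a := 0)) z)"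
          unfolding 4 sum_upd using y 4 B_k by (auto simp: B_same D_same)
        then show "cycle I B D f i v" unfolding exact by (rule exI[of _ "y(a := 0)"])
      qed
      finally show ?thesis .
    next
      case 5
      have "cycle I ?B ?D f i v \<longleftrightarrow> cycle I B D f i v"
        using 5 by (cases i) (auto simp: cycle_0 cycle_Suc B_same D_same)
      then show ?thesis unfolding exact using 5 by (simp add: B_same D_same)
    qed
  qed
  have surj: "\<exists>v. (\<Sum>z\<in>?B 0. f z * v z) - 1 \<in> I"
  proof -
    obtain v where v: "(\<Sum>z\<in>B 0. f z * v z) - 1 \<in> I" using res_surj[OF I res] ..
    show ?thesis
    proof (cases k)
      case 0
      have aug: "(\<Sum>z\<in>B 0. f z * D 0 z b) \<in> I" by (rule res_aug_D[OF I res]) (use b 0 in simp)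
      have "(\<Sum>z\<in>?B 0. f z * clear v z) - 1
          = (\<Sum>z\<in>B 0. f z * v z) - 1 - w * v a * (\<Sum>z\<in>B 0. f z * D 0 z b)"
        using clear_sum[of f v] B_k 0 by simp
      also have "\<dots> \<in> I" by (rule graded_idealD(7)[OF I v graded_idealD(3)[OF I aug]])
      finally show ?thesis by (rule exI[of _ "clear v"])
    next
      case (Suc j)
      then have "?B 0 = B 0" by (intro B_same) simp_all
      then show ?thesis by (intro exI[of _ v]) (simp add: v)
    qed
  qed
  have D_hom: "?D i x y \<in> homogeneous_polys (dg (Suc i) y - dg i x)" if x: "x \<in> ?B i" and y: "y \<in> ?B (Suc i)" for i x y
  proof -
    have x': "x \<in> B i" and y': "y \<in> B (Suc i)" using x y by (simp_all add: trim_basis_def)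
    have 1: "D i x y \<in> homogeneous_polys (dg (Suc i) y - dg i x)" by (rule res_hom[OF I res x' y'])
    have 2: "D k x b * w * D k a y \<in> homogeneous_polys (dg (Suc k) y - dg k x)" if "i = k"
      using that x' y' a b dg_eq w_hom
      by (intro hom_mult'[OF hom_mult'[OF res_hom[OF I res] w_hom refl] res_hom[OF I res]]) auto
    show ?thesis using 1 2 by (auto simp: trim_maps_def intro: hom_diff)
  qed
  have fin': "finite (?B i)" for i using fin by (simp add: trim_basis_def)
  have f_hom: "f x \<in> homogeneous_polys (dg 0 x)" if "x \<in> ?B 0" for x
    using res_hom_aug[OF I res] that by (simp add: trim_basis_def)
  show ?thesis unfolding resolves_def
    by (intro conjI allI ballI fin' D_hom f_hom surj exact')
qed

text \<open>An entry with nonzero constant term joins basis elements of equal degree, hence it is a constant and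
a unit. Each cancellation makes the total rank smaller, so the process stops.\<close>

theorem minimal_resolution_exists:
  fixes I :: "('x::finite, 'k::field) mpol set"
  assumes I: "graded_ideal I" and "resolves I B dg D f" and "finite (SIGMA i:UNIV. B i)"
  shows "\<exists>B' D'. resolves I B' dg D' f \<and> minimal_maps B' D'"
  using assms(2,3)
proof (induction "card (SIGMA i:UNIV. B i)" arbitrary: B D rule: less_induct)
  case less
  note res = less.prems(1) and fin = less.prems(2)
  show ?case
  proof (cases "minimal_maps B D")
    case True
    then show ?thesis using res by blast
  next
    case False
    then obtain k a b where a: "a \<in> B k" and b: "b \<in> B (Suc k)" and nz: "lk (D k a b) 0 \<noteq> 0"
      unfolding minimal_maps_def by blast
    note hom = res_hom[OF I res a b]
    have deg: "dg (Suc k) b = dg k a"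
      by (rule ccontr) (use hom_const_term[OF hom] nz in simp)
    define c where "c = lk (D k a b) 0"
    have "D k a b = Poly_Mapping.single 0 c"
      unfolding c_def by (rule hom_deg_0_const) (use hom deg in simp)
    then have w: "Poly_Mapping.single 0 (inverse c) * D k a b = 1"
      using nz by (simp add: mult_single c_def[symmetric])
    have w_hom: "Poly_Mapping.single 0 (inverse c) \<in> (homogeneous_polys 0 :: ('x, 'k) mpol set)"
      using hom_single[of 0 "inverse c"] by simp
    let ?B = "trim_basis B k a b" and ?D = "trim_maps D k a b (Poly_Mapping.single 0 (inverse c))"
    have "resolves I ?B dg ?D f" by (rule resolves_trim[OF I res a b w w_hom deg])
    moreover have "(SIGMA i:UNIV. ?B i) \<subset> (SIGMA i:UNIV. B i)"
    proof
      show "(SIGMA i:UNIV. ?B i) \<subseteq> (SIGMA i:UNIV. B i)" by (auto simp: trim_basis_def)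
      have "(k, a) \<in> (SIGMA i:UNIV. B i) - (SIGMA i:UNIV. ?B i)" using a by (simp add: trim_basis_def)
      then show "(SIGMA i:UNIV. ?B i) \<noteq> (SIGMA i:UNIV. B i)" by blast
    qed
    ultimately show ?thesis
      by (intro less.hyps[of ?B ?D] psubset_card_mono[OF fin] finite_subset[OF psubset_imp_subset fin])
  qed
qed

section \<open>The simplicial boundary and its contraction\<close>

text \<open>A chain on the full simplex with vertices \<open>0, \<dots>, m - 1\<close> is given by its coefficients, a function on
faces. The coefficient of its boundary at the face \<open>A\<close> collects the faces that have \<open>A\<close> as a facet.
The empty face is included, so this is the augmented chain complex.\<close>

definition face_sign :: "nat \<Rightarrow> nat set \<Rightarrow> 'k::comm_ring_1" where
  "face_sign x A = (-1) ^ card {y\<in>A. y < x}"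

definition boundary :: "nat \<Rightarrow> (nat set \<Rightarrow> 'k::comm_ring_1) \<Rightarrow> nat set \<Rightarrow> 'k" where
  "boundary m c A = (\<Sum>x\<in>{..<m} - A. face_sign x A * c (insert x A))"

lemma boundary_cong: "(\<And>x. x < m \<Longrightarrow> x \<notin> A \<Longrightarrow> c (insert x A) = c' (insert x A)) \<Longrightarrow> boundary m c A = boundary m c' A"
  unfolding boundary_def by (intro sum.cong) auto

lemma face_sign_insert:
  assumes "finite A" "y \<notin> A" "y \<noteq> x"
  shows "face_sign x (insert y A) = (if y < x then - face_sign x A else face_sign x A)"
proof -
  have "{z\<in>insert y A. z < x} = (if y < x then insert y {z\<in>A. z < x} else {z\<in>A. z < x})" by auto
  then show ?thesis using assms by (simp add: face_sign_def)
qed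

lemma face_sign_below: "(\<And>y. y \<in> A \<Longrightarrow> x \<le> y) \<Longrightarrow> face_sign x A = 1"
proof -
  assume "\<And>y. y \<in> A \<Longrightarrow> x \<le> y"
  then have "{y\<in>A. y < x} = {}" by fastforce
  then show ?thesis by (simp only: face_sign_def card.empty power_0)
qed

text \<open>The terms cancel in pairs \<open>(x, y)\<close>, \<open>(y, x)\<close>. Comparing the sum with its own negative would not be
enough in characteristic \<open>2\<close>.\<close>

lemma sum_antisymmetric:
  fixes h :: "nat \<Rightarrow> nat \<Rightarrow> 'k::comm_ring_1"
  assumes fin: "finite N" and anti: "\<And>x y. x \<in> N \<Longrightarrow> y \<in> N \<Longrightarrow> x < y \<Longrightarrow> h y x = - h x y"
  shows "(\<Sum>x\<in>N. \<Sum>y\<in>N - {x}. h x y) = 0"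
proof -
  define up where "up x y = (if x < y then h x y else 0)" for x y
  have inner: "(\<Sum>y\<in>N - {x}. h x y) = (\<Sum>y\<in>N. up x y) - (\<Sum>y\<in>N. up y x)" if "x \<in> N" for x
  proof -
    have "(\<Sum>y\<in>N - {x}. h x y) = (\<Sum>y\<in>N - {x}. up x y - up y x)"
    proof (intro sum.cong refl)
      fix y assume y: "y \<in> N - {x}"
      then consider "x < y" | "y < x" by fastforce
      then show "h x y = up x y - up y x"
        using anti[of y x] that y by cases (simp_all add: up_def)
    qed
    also have "\<dots> = (\<Sum>y\<in>N. up x y - up y x)"
      using sum.remove[OF fin that, of "\<lambda>y. up x y - up y x"] by simp
    finally show ?thesis by (simp add: sum_subtractf)
  qed
  have "(\<Sum>x\<in>N. \<Sum>y\<in>N - {x}. h x y) = (\<Sum>x\<in>N. (\<Sum>y\<in>N. up x y) - (\<Sum>y\<in>N. up y x))"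
    by (intro sum.cong refl inner)
  also have "\<dots> = (\<Sum>x\<in>N. \<Sum>y\<in>N. up x y) - (\<Sum>x\<in>N. \<Sum>y\<in>N. up y x)" by (rule sum_subtractf)
  also have "(\<Sum>x\<in>N. \<Sum>y\<in>N. up y x) = (\<Sum>x\<in>N. \<Sum>y\<in>N. up x y)" by (rule sum.swap)
  finally show ?thesis by simp
qed

lemma boundary_boundary:
  assumes fin: "finite A"
  shows "boundary m (boundary m c) A = 0"
proof -
  define h where "h x y = face_sign x A * (face_sign y (insert x A) * c (insert y (insert x A)))" for x y
  have "boundary m (boundary m c) A = (\<Sum>x\<in>{..<m} - A. \<Sum>y\<in>{..<m} - A - {x}. h x y)"
    unfolding boundary_def h_def sum_distrib_left by (intro sum.cong refl) auto
  also have "\<dots> = 0"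
  proof (rule sum_antisymmetric)
    fix x y assume xy: "x \<in> {..<m} - A" "y \<in> {..<m} - A" "x < y"
    have "face_sign y (insert x A) = - (face_sign y A :: 'a)" "face_sign x (insert y A) = (face_sign x A :: 'a)"
      using face_sign_insert[OF fin, of x y] face_sign_insert[OF fin, of y x] xy by simp_all
    moreover have "insert y (insert x A) = insert x (insert y A)" by blast
    ultimately show "h y x = - h x y" by (simp add: h_def mult.left_commute)
  qed simp
  finally show ?thesis .
qed

definition cone :: "nat \<Rightarrow> (nat set \<Rightarrow> 'k::comm_ring_1) \<Rightarrow> nat set \<Rightarrow> 'k" where
  "cone g c A = (if g \<in> A then c (A - {g}) else 0)"

text \<open>Coning with \<open>g\<close> contracts the complex. The support condition says that \<open>g\<close> comes first among the
vertices in use, so that adding \<open>g\<close> to a face has sign \<open>1\<close> and changes the signs of all other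
vertices.\<close>

lemma boundary_cone:
  fixes c :: "nat set \<Rightarrow> 'k::comm_ring_1"
  assumes g: "g < m" and A: "A \<subseteq> {..<m}" and supp: "\<And>B y. c B \<noteq> 0 \<Longrightarrow> y \<in> B \<Longrightarrow> g \<le> y"
  shows "boundary m (cone g c) A = c A - cone g (boundary m c) A"
proof -
  have fin: "finite A" using A finite_subset by blast
  have sign: "face_sign g B * c C = c C" if "B \<subseteq> C" for B C
  proof (cases "c C = 0")
    case False
    have "face_sign g B = (1 :: 'k)" by (rule face_sign_below) (use supp[OF False] that in blast)
    then show ?thesis by simp
  qed simp
  show ?thesis
  proof (cases "g \<in> A")
    case False
    have "boundary m (cone g c) A = (\<Sum>x\<in>{..<m} - A. if x = g then face_sign g A * c A else 0)"
      unfolding boundary_def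
    proof (intro sum.cong refl)
      fix x assume "x \<in> {..<m} - A"
      have "insert g A - {g} = A" using False by blast
      then show "face_sign x A * cone g c (insert x A) = (if x = g then face_sign g A * c A else 0)"
        using False by (simp add: cone_def)
    qed
    also have "\<dots> = face_sign g A * c A" using g False by simp
    finally show ?thesis using False sign[of A A] by (simp add: cone_def)
  next
    case True
    define A' where "A' = A - {g}"
    have A': "A = insert g A'" "g \<notin> A'" "finite A'" using True fin by (auto simp: A'_def)
    have "boundary m (cone g c) A = (\<Sum>x\<in>{..<m} - A. - (face_sign x A' * c (insert x A')))"
      unfolding boundary_def
    proof (intro sum.cong refl)
      fix x assume x: "x \<in> {..<m} - A"
      then have "insert x A - {g} = insert x A'" and xg: "x \<noteq> g" using True by (auto simp: A'_def)
      then have c: "cone g c (insert x A) = c (insert x A')" using True by (simp add: cone_def)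
      show "face_sign x A * cone g c (insert x A) = - (face_sign x A' * c (insert x A'))"
      proof (cases "c (insert x A') = 0")
        case False
        then have "g < x" using supp[of "insert x A'" x] xg by simp
        then have "face_sign x A = - (face_sign x A' :: 'k)"
          unfolding A'(1) using face_sign_insert[OF A'(3,2), of x] by simp
        then show ?thesis using c by simp
      qed (simp add: c)
    qed
    moreover have "boundary m c A' = c A + (\<Sum>x\<in>{..<m} - A. face_sign x A' * c (insert x A'))"
    proof -
      have "{..<m} - A' = insert g ({..<m} - A)" unfolding A'(1) using A'(2) g by auto
      then have "boundary m c A' = face_sign g A' * c (insert g A') + (\<Sum>x\<in>{..<m} - A. face_sign x A' * c (insert x A'))"
        unfolding boundary_def using True by simp
      moreover have "face_sign g A' * c (insert g A') = c A"
        unfolding A'(1)[symmetric] by (rule sign) (simp add: A'_def)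
      ultimately show ?thesis by simp
    qed
    moreover have "cone g (boundary m c) A = boundary m c A'"
      unfolding cone_def A'_def by (rule if_P[OF True])
    ultimately show ?thesis by (simp add: sum_negf)
  qed
qed

section \<open>The Taylor resolution\<close>

lemma lookup_mono_lcm: "lk (mono_lcm U) x = Max (insert 0 ((\<lambda>u. lk u x) ` U))"
  unfolding mono_lcm_def by (rule fun_cong[OF lookup_Abs_poly_mapping]) simp

lemma mono_lcm_dvd_iff:
  assumes "finite U"
  shows "mono_dvd (mono_lcm U) t \<longleftrightarrow> (\<forall>u\<in>U. mono_dvd u t)"
proof -
  have "lk (mono_lcm U) x \<le> lk t x \<longleftrightarrow> (\<forall>u\<in>U. lk u x \<le> lk t x)" for x
    using assms by (simp add: lookup_mono_lcm)
  then show ?thesis unfolding mono_dvd_def by (simp only:) blast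
qed

lemma dvd_mono_lcm: "finite U \<Longrightarrow> u \<in> U \<Longrightarrow> mono_dvd u (mono_lcm U)"
  using mono_lcm_dvd_iff[THEN iffD1, OF _ mono_dvd_refl, of U] by (rule bspec)

lemma mono_lcm_empty [simp]: "mono_lcm {} = 0"
  by (intro poly_mapping_eqI) (simp add: lookup_mono_lcm)

lemma mono_lcm_mono: "finite V \<Longrightarrow> U \<subseteq> V \<Longrightarrow> mono_dvd (mono_lcm U) (mono_lcm V)"
  by (rule mono_lcm_dvd_iff[THEN iffD2]) (auto dest: finite_subset intro: dvd_mono_lcm)

lemma mono_lcm_singleton: "mono_lcm {u} = u"
proof (rule mono_dvd_antisym)
  show "mono_dvd (mono_lcm {u}) u" by (rule mono_lcm_dvd_iff[THEN iffD2]) simp_all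
  show "mono_dvd u (mono_lcm {u})" by (rule dvd_mono_lcm) simp_all
qed

lemma mono_dvd_minus_iff:
  assumes "mono_dvd a b" "mono_dvd a t"
  shows "mono_dvd (b - a) (t - a) \<longleftrightarrow> mono_dvd b t"
    and "t - a - (b - a) = t - b"
proof -
  show "mono_dvd (b - a) (t - a) \<longleftrightarrow> mono_dvd b t"
    using assms by (simp add: mono_dvd_def minus_poly_mapping.rep_eq le_diff_conv)
  show "t - a - (b - a) = t - b"
    using assms by (intro poly_mapping_eqI) (simp add: mono_dvd_def minus_poly_mapping.rep_eq)
qed

text \<open>The generators are \<open>g 0, \<dots>, g (m - 1)\<close>, and a basis element of the Taylor resolution is the set of
indices of a subset of them.\<close>

definition taylor_basis :: "nat \<Rightarrow> nat \<Rightarrow> nat set set" where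
  "taylor_basis m i = {A. A \<subseteq> {..<m} \<and> card A = i}"

definition taylor_deg :: "(nat \<Rightarrow> 'x::finite mono) \<Rightarrow> nat \<Rightarrow> nat set \<Rightarrow> int" where
  "taylor_deg g i A = int (mono_deg (mono_lcm (g ` A)))"

definition taylor :: "(nat \<Rightarrow> 'x::finite mono) \<Rightarrow> nat \<Rightarrow> nat set \<Rightarrow> nat set \<Rightarrow> ('x, 'k::comm_ring_1) mpol" where
  "taylor g i A B = (if \<exists>x. x \<notin> A \<and> B = insert x A
     then Poly_Mapping.single (mono_lcm (g ` B) - mono_lcm (g ` A)) (face_sign (the_elem (B - A)) A) else 0)"

lemma taylor_other: "\<not> (\<exists>x. x \<notin> A \<and> B = insert x A) \<Longrightarrow> taylor g i A B = 0"
  unfolding taylor_def by (rule if_not_P)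

lemma taylor_insert:
  "x \<notin> A \<Longrightarrow> taylor g i A (insert x A)
     = Poly_Mapping.single (mono_lcm (g ` insert x A) - mono_lcm (g ` A)) (face_sign x A)"
  by (auto simp: taylor_def insert_Diff_if)

text \<open>The multiple \<open>t e\<^sub>A\<close> of a basis element by a monomial has multidegree \<open>t lcm A\<close>. In each multidegree
\<open>\<mu>\<close> a vector thus becomes a chain of scalars, with coefficient \<open>coef g \<mu> v A\<close> at \<open>A\<close>.\<close>

definition coef :: "(nat \<Rightarrow> 'x::finite mono) \<Rightarrow> 'x mono \<Rightarrow> (nat set \<Rightarrow> ('x, 'k::comm_ring_1) mpol) \<Rightarrow> nat set \<Rightarrow> 'k" where
  "coef g \<mu> v A = (if mono_dvd (mono_lcm (g ` A)) \<mu> then lk (v A) (\<mu> - mono_lcm (g ` A)) else 0)"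

lemma coef_eqI:
  assumes "\<And>\<mu>. coef g \<mu> v A = coef g \<mu> w A"
  shows "v A = w A"
proof (rule poly_mapping_eqI)
  fix t
  show "lk (v A) t = lk (w A) t"
    using assms[of "t + mono_lcm (g ` A)"] by (simp add: coef_def)
qed

context
  fixes g :: "nat \<Rightarrow> 'x::finite mono" and m :: nat
begin

abbreviation "lcm_of A \<equiv> mono_lcm (g ` A)"

definition taylor_app :: "(nat set \<Rightarrow> ('x, 'k::comm_ring_1) mpol) \<Rightarrow> nat set \<Rightarrow> ('x, 'k) mpol" where
  "taylor_app v A = (\<Sum>x\<in>{..<m} - A. Poly_Mapping.single (lcm_of (insert x A) - lcm_of A) (face_sign x A) * v (insert x A))"

lemma sum_taylor:
  fixes v :: "nat set \<Rightarrow> ('x, 'k::comm_ring_1) mpol"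
  assumes A: "A \<in> taylor_basis m i"
  shows "(\<Sum>B\<in>taylor_basis m (Suc i). taylor g i A B * v B) = taylor_app v A"
proof -
  have A: "A \<subseteq> {..<m}" "card A = i" "finite A" using A finite_subset by (auto simp: taylor_basis_def)
  have fin: "finite (taylor_basis m (Suc i))"
    by (rule finite_subset[of _ "Pow {..<m}"]) (auto simp: taylor_basis_def)
  have "(\<Sum>B\<in>taylor_basis m (Suc i). taylor g i A B * v B)
      = (\<Sum>B\<in>(\<lambda>x. insert x A) ` ({..<m} - A). taylor g i A B * v B)"
  proof (rule sum.mono_neutral_right[OF fin])
    show "(\<lambda>x. insert x A) ` ({..<m} - A) \<subseteq> taylor_basis m (Suc i)"
      using A by (auto simp: taylor_basis_def)
    show "\<forall>B\<in>taylor_basis m (Suc i) - (\<lambda>x. insert x A) ` ({..<m} - A). taylor g i A B * v B = 0"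
    proof
      fix B assume B: "B \<in> taylor_basis m (Suc i) - (\<lambda>x. insert x A) ` ({..<m} - A)"
      have "\<not> (\<exists>x. x \<notin> A \<and> B = insert x A)" using B by (auto simp: taylor_basis_def)
      then show "taylor g i A B * v B = 0" unfolding taylor_other[OF \<open>\<not> _\<close>] by simp
    qed
  qed
  also have "\<dots> = (\<Sum>x\<in>{..<m} - A. taylor g i A (insert x A) * v (insert x A))"
    by (subst sum.reindex) (auto simp: inj_on_def)
  also have "\<dots> = taylor_app v A"
    unfolding taylor_app_def by (intro sum.cong refl) (simp add: taylor_insert)
  finally show ?thesis .
qed

text \<open>The monomials in the Taylor matrices are such that multidegrees are preserved. Therefore in every
multidegree the Taylor map is the boundary map of the simplex.\<close>

lemma coef_taylor_app:
  assumes A: "A \<subseteq> {..<m}"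
  shows "coef g \<mu> (taylor_app v) A = boundary m (coef g \<mu> v) A"
proof -
  have fin: "finite A" using A finite_subset by blast
  have dvd: "mono_dvd (lcm_of A) (lcm_of (insert x A))" for x
    by (rule mono_lcm_mono) (use fin in auto)
  show ?thesis
  proof (cases "mono_dvd (lcm_of A) \<mu>")
    case True
    then have "coef g \<mu> (taylor_app v) A = lk (taylor_app v A) (\<mu> - lcm_of A)" by (simp add: coef_def)
    also have "\<dots> = boundary m (coef g \<mu> v) A"
      unfolding taylor_app_def lookup_sum boundary_def
    proof (intro sum.cong refl)
      fix x
      show "lk (Poly_Mapping.single (lcm_of (insert x A) - lcm_of A) (face_sign x A) * v (insert x A)) (\<mu> - lcm_of A)
          = face_sign x A * coef g \<mu> v (insert x A)"
        unfolding lookup_monom_times mono_dvd_minus_iff[OF dvd True] coef_def by simp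
    qed
    finally show ?thesis .
  next
    case False
    then have "\<not> mono_dvd (lcm_of (insert x A)) \<mu>" for x
      using mono_dvd_trans[OF dvd[of x], of \<mu>] by (rule contrapos_nn)
    then have "coef g \<mu> v (insert x A) = 0" for x
      unfolding coef_def by (rule if_not_P)
    then show ?thesis using False by (simp add: coef_def[of g \<mu> "taylor_app v"] boundary_def)
  qed
qed

text \<open>The contraction of the Taylor complex uses a different vertex in each multidegree. The resulting
coefficients are those of a polynomial: each nonzero one comes from a term of one of the finitely
many polynomials \<open>v (C - {x})\<close>, and different ones at the same \<open>x\<close> come from different terms.\<close>

lemma taylor_contraction_exists:
  fixes c :: "'x mono \<Rightarrow> nat set \<Rightarrow> 'k::comm_ring_1"
  assumes fin: "finite C"
    and c: "\<And>\<mu> A. c \<mu> A \<noteq> 0 \<Longrightarrow> coef g \<mu> v A \<noteq> 0"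
  shows "\<exists>p. \<forall>t. lk p t = cone (h t) (c (t + lcm_of C)) C"
proof -
  have "finite {t. cone (h t) (c (t + lcm_of C)) C \<noteq> 0}"
  proof (rule finite_subset)
    show "{t. cone (h t) (c (t + lcm_of C)) C \<noteq> 0}
        \<subseteq> (\<Union>x\<in>C. (\<lambda>t. t + (lcm_of C - lcm_of (C - {x}))) -` Poly_Mapping.keys (v (C - {x})))"
    proof
      fix t assume "t \<in> {t. cone (h t) (c (t + lcm_of C)) C \<noteq> 0}"
      then have x: "h t \<in> C" and "c (t + lcm_of C) (C - {h t}) \<noteq> 0"
        by (auto simp: cone_def split: if_splits)
      from c[OF this(2)] have nz: "lk (v (C - {h t})) (t + lcm_of C - lcm_of (C - {h t})) \<noteq> 0"
        by (auto simp: coef_def split: if_splits)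
      have "mono_dvd (lcm_of (C - {h t})) (lcm_of C)"
        by (rule mono_lcm_mono) (use fin in auto)
      then have "t + lcm_of C - lcm_of (C - {h t}) = t + (lcm_of C - lcm_of (C - {h t}))"
        by (intro poly_mapping_eqI) (simp add: mono_dvd_def minus_poly_mapping.rep_eq lookup_add)
      then show "t \<in> (\<Union>x\<in>C. (\<lambda>t. t + (lcm_of C - lcm_of (C - {x}))) -` Poly_Mapping.keys (v (C - {x})))"
        using x nz by (auto simp: in_keys_iff)
    qed
    show "finite (\<Union>x\<in>C. (\<lambda>t. t + (lcm_of C - lcm_of (C - {x}))) -` Poly_Mapping.keys (v (C - {x})))"
      using fin by (intro finite_UN_I finite_vimageI) (auto simp: inj_on_def)
  qed
  then show ?thesis by (intro exI[of _ "Abs_poly_mapping (\<lambda>t. cone (h t) (c (t + lcm_of C)) C)"]) simp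
qed

text \<open>In multidegree \<open>\<mu>\<close> the Taylor complex is the augmented chain complex of the simplex on the set \<open>G \<mu>\<close>
of generators that divide \<open>\<mu>\<close>. It is contracted by coning with the smallest vertex, unless there
is no vertex at all; in that case only the empty face is left, and \<open>\<mu>\<close> is a monomial outside of
the ideal.\<close>

theorem taylor_resolves:
  shows "resolves (mono_ideal (g ` {..<m}) :: ('x, 'k::field) mpol set)
    (taylor_basis m) (taylor_deg g) (taylor g) (\<lambda>_. 1)"
proof -
  define I where "I = (mono_ideal (g ` {..<m}) :: ('x, 'k) mpol set)"
  have I: "graded_ideal I" unfolding I_def by (rule graded_ideal_mono_ideal)
  have in_I: "p \<in> I \<longleftrightarrow> (\<forall>t. lk p t \<noteq> 0 \<longrightarrow> (\<exists>k<m. mono_dvd (g k) t))" for p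
    by (auto simp: I_def mono_ideal_eq)
  have basis_0: "taylor_basis m 0 = {{}}"
    by (auto simp: taylor_basis_def dest: finite_subset)
  have basisD: "A \<subseteq> {..<m}" "finite A" "card A = i" if "A \<in> taylor_basis m i" for A i
    using that finite_subset by (auto simp: taylor_basis_def)
  have basis_insert: "insert x A \<in> taylor_basis m (Suc i)"
    if "A \<in> taylor_basis m i" "x < m" "x \<notin> A" for A i x
    using basisD[OF that(1)] that by (auto simp: taylor_basis_def)
  have basis_delete: "A - {x} \<in> taylor_basis m i" if "A \<in> taylor_basis m (Suc i)" "x \<in> A" for A i x
    using basisD[OF that(1)] that by (auto simp: taylor_basis_def)
  have cycle_SucT: "cycle I (taylor_basis m) (taylor g) (\<lambda>_. 1) (Suc j) v
      \<longleftrightarrow> (\<forall>A\<in>taylor_basis m j. taylor_app v A = 0)" for j v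
    unfolding cycle_Suc by (intro ball_cong refl) (simp only: sum_taylor)
  have cycle_0T: "cycle I (taylor_basis m) (taylor g) (\<lambda>_. 1) 0 v \<longleftrightarrow> v {} \<in> I" for v
    unfolding cycle_0 basis_0 by simp
  have exact1: "cycle I (taylor_basis m) (taylor g) (\<lambda>_. 1) i v"
    if y: "\<forall>A\<in>taylor_basis m i. v A = taylor_app y A" for i v y
  proof (cases i)
    case 0
    have "v {} = taylor_app y {}" using y 0 basis_0 by simp
    also have "\<dots> \<in> I"
      unfolding taylor_app_def
    proof (intro graded_ideal_sum[OF I] graded_idealD(4)[OF I])
      fix x assume "x \<in> {..<m} - {}"
      then show "Poly_Mapping.single (lcm_of {x} - lcm_of {}) (face_sign x {}) \<in> I"
        by (auto simp: in_I lookup_single when_def mono_lcm_singleton)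
    qed
    finally show ?thesis using 0 cycle_0T by simp
  next
    case (Suc j)
    have "taylor_app v A = 0" if A: "A \<in> taylor_basis m j" for A
    proof -
      have "taylor_app v A = (\<lambda>_. 0) A"
      proof (rule coef_eqI)
        fix \<mu>
        have "coef g \<mu> (taylor_app v) A = boundary m (coef g \<mu> v) A"
          by (rule coef_taylor_app[OF basisD(1)[OF A]])
        also have "\<dots> = boundary m (boundary m (coef g \<mu> y)) A"
        proof (rule boundary_cong)
          fix x assume x: "x < m" "x \<notin> A"
          have iA: "insert x A \<in> taylor_basis m i" using basis_insert[OF A x] Suc by simp
          have "coef g \<mu> v (insert x A) = coef g \<mu> (taylor_app y) (insert x A)"
            unfolding coef_def using y iA by simp
          also have "\<dots> = boundary m (coef g \<mu> y) (insert x A)"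
            by (rule coef_taylor_app[OF basisD(1)[OF iA]])
          finally show "coef g \<mu> v (insert x A) = boundary m (coef g \<mu> y) (insert x A)" .
        qed
        also have "\<dots> = 0" by (rule boundary_boundary[OF basisD(2)[OF A]])
        finally show "coef g \<mu> (taylor_app v) A = coef g \<mu> (\<lambda>_. 0) A" by (simp add: coef_def)
      qed
      then show ?thesis .
    qed
    then show ?thesis using Suc cycle_SucT by simp
  qed
  have exact2: "\<exists>y. \<forall>A\<in>taylor_basis m i. v A = taylor_app y A"
    if cyc: "cycle I (taylor_basis m) (taylor g) (\<lambda>_. 1) i v" for i v
  proof -
    define c where "c \<mu> A = (if A \<in> taylor_basis m i then coef g \<mu> v A else 0)" for \<mu> A
    define G where "G \<mu> = {k. k < m \<and> mono_dvd (g k) \<mu>}" for \<mu>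
    define g0 where "g0 \<mu> = Min (G \<mu>)" for \<mu>
    have finG: "finite (G \<mu>)" for \<mu> by (simp add: G_def)
    have g0: "g0 \<mu> \<in> G \<mu>" if "G \<mu> \<noteq> {}" for \<mu> using Min_in[OF finG that] by (simp add: g0_def)
    have supp: "A \<subseteq> G \<mu>" "G \<mu> \<noteq> {}" if nz: "c \<mu> A \<noteq> 0" for \<mu> A
    proof -
      have A: "A \<in> taylor_basis m i" and cf: "coef g \<mu> v A \<noteq> 0"
        using nz by (auto simp: c_def split: if_splits)
      have dvd: "mono_dvd (lcm_of A) \<mu>" and lk: "lk (v A) (\<mu> - lcm_of A) \<noteq> 0"
        using cf by (auto simp: coef_def split: if_splits)
      show sub: "A \<subseteq> G \<mu>"
        using dvd basisD[OF A] by (auto simp: G_def mono_lcm_dvd_iff)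
      show "G \<mu> \<noteq> {}"
      proof (cases i)
        case 0
        then have "A = {}" using A basis_0 by simp
        moreover have "v {} \<in> I" using cyc 0 cycle_0T by simp
        ultimately show ?thesis using lk by (auto simp: in_I G_def)
      next
        case (Suc j)
        then have "A \<noteq> {}" using basisD(3)[OF A] by auto
        then show ?thesis using sub by blast
      qed
    qed
    have "\<exists>p. \<forall>t. lk p t = cone (g0 (t + lcm_of C)) (c (t + lcm_of C)) C" if "finite C" for C
    proof (rule taylor_contraction_exists[OF that])
      show "coef g \<mu> v A \<noteq> 0" if "c \<mu> A \<noteq> 0" for \<mu> A
        using that by (auto simp: c_def split: if_splits)
    qed
    then have "\<forall>C. \<exists>p. finite C \<longrightarrow> (\<forall>t. lk p t = cone (g0 (t + lcm_of C)) (c (t + lcm_of C)) C)"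
      by (intro allI) (simp only: ex_simps, intro impI)
    from choice[OF this] obtain y
      where "\<forall>C. finite C \<longrightarrow> (\<forall>t. lk (y C) t = cone (g0 (t + lcm_of C)) (c (t + lcm_of C)) C)" ..
    then have y: "lk (y C) t = cone (g0 (t + lcm_of C)) (c (t + lcm_of C)) C" if "finite C" for C t
      using that by simp
    have coef_y: "coef g \<mu> y C = cone (g0 \<mu>) (c \<mu>) C" if C: "C \<subseteq> {..<m}" for \<mu> C
    proof -
      have finC: "finite C" using C finite_subset by blast
      show ?thesis
      proof (cases "mono_dvd (lcm_of C) \<mu>")
        case True
        then show ?thesis by (simp add: coef_def y[OF finC] mono_minus_add)
      next
        case False
        have "cone (g0 \<mu>) (c \<mu>) C = 0"
        proof (rule ccontr)
          assume "cone (g0 \<mu>) (c \<mu>) C \<noteq> 0"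
          then have "g0 \<mu> \<in> C" and nz: "c \<mu> (C - {g0 \<mu>}) \<noteq> 0" by (auto simp: cone_def split: if_splits)
          then have "C \<subseteq> G \<mu>" using supp[OF nz] g0 by blast
          then have "mono_dvd (lcm_of C) \<mu>" using finC by (auto simp: mono_lcm_dvd_iff G_def)
          then show False using False by blast
        qed
        then show ?thesis using False by (simp add: coef_def)
      qed
    qed
    have "v A = taylor_app y A" if A: "A \<in> taylor_basis m i" for A
    proof (rule coef_eqI)
      fix \<mu>
      note A' = basisD[OF A]
      have "coef g \<mu> (taylor_app y) A = boundary m (coef g \<mu> y) A" by (rule coef_taylor_app[OF A'(1)])
      also have "\<dots> = boundary m (cone (g0 \<mu>) (c \<mu>)) A"
        by (rule boundary_cong) (use A'(1) coef_y in simp)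
      also have "\<dots> = c \<mu> A"
      proof (cases "G \<mu> = {}")
        case True
        then have "c \<mu> = (\<lambda>_. 0)" using supp(2) by blast
        then show ?thesis by (simp add: boundary_def cone_def)
      next
        case False
        have "boundary m (cone (g0 \<mu>) (c \<mu>)) A = c \<mu> A - cone (g0 \<mu>) (boundary m (c \<mu>)) A"
        proof (rule boundary_cone)
          show "g0 \<mu> < m" using g0[OF False] by (simp add: G_def)
          show "A \<subseteq> {..<m}" by (rule A'(1))
          show "g0 \<mu> \<le> x" if "c \<mu> B \<noteq> 0" "x \<in> B" for B x
            unfolding g0_def by (rule Min_le[OF finG]) (use supp(1)[OF that(1)] that(2) in blast)
        qed
        also have "cone (g0 \<mu>) (boundary m (c \<mu>)) A = 0"
        proof (cases "g0 \<mu> \<in> A")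
          case g0A: True
          define A0 where "A0 = A - {g0 \<mu>}"
          have "card A \<noteq> 0" using g0A A'(2) by auto
          then obtain j where j: "i = Suc j" using A'(3) by (cases i) auto
          have A0: "A0 \<in> taylor_basis m j" using basis_delete[of A j] A g0A j by (simp add: A0_def)
          have "boundary m (c \<mu>) A0 = boundary m (coef g \<mu> v) A0"
            by (rule boundary_cong) (use basis_insert[OF A0] j in \<open>simp add: c_def\<close>)
          also have "\<dots> = coef g \<mu> (taylor_app v) A0"
            by (rule coef_taylor_app[OF basisD(1)[OF A0], symmetric])
          also have "\<dots> = 0" using cyc A0 unfolding j cycle_SucT by (simp add: coef_def)
          finally show ?thesis using g0A by (simp add: cone_def A0_def)
        qed (simp add: cone_def)
        finally show ?thesis by simp
      qed
      also have "\<dots> = coef g \<mu> v A" using A by (simp add: c_def)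
      finally show "coef g \<mu> v A = coef g \<mu> (taylor_app y) A" ..
    qed
    then show ?thesis by (intro exI[of _ y] ballI)
  qed
  have fin: "finite (taylor_basis m i)" for i
    by (rule finite_subset[of _ "Pow {..<m}"]) (auto simp: taylor_basis_def)
  have hom: "(taylor g i A B :: ('x, 'k) mpol) \<in> homogeneous_polys (taylor_deg g (Suc i) B - taylor_deg g i A)"
    if B: "B \<in> taylor_basis m (Suc i)" for i A B
  proof (cases "\<exists>x. x \<notin> A \<and> B = insert x A")
    case True
    then have "mono_dvd (lcm_of A) (lcm_of B)"
      using basisD(2)[OF B] by (intro mono_lcm_mono) auto
    then have "taylor_deg g (Suc i) B - taylor_deg g i A = int (mono_deg (lcm_of B - lcm_of A))"
      by (simp add: mono_deg_minus taylor_deg_def)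
    then show ?thesis using True by (simp add: taylor_def hom_single)
  next
    case False
    show ?thesis unfolding taylor_other[OF False] by simp
  qed
  have exact: "cycle I (taylor_basis m) (taylor g) (\<lambda>_. 1) i v
      \<longleftrightarrow> (\<exists>y. \<forall>a\<in>taylor_basis m i. v a = (\<Sum>b\<in>taylor_basis m (Suc i). taylor g i a b * y b))" for i v
  proof -
    have eq: "(\<forall>a\<in>taylor_basis m i. v a = (\<Sum>b\<in>taylor_basis m (Suc i). taylor g i a b * y b))
        \<longleftrightarrow> (\<forall>a\<in>taylor_basis m i. v a = taylor_app y a)" for y
      by (intro ball_cong refl) (simp only: sum_taylor)
    show ?thesis unfolding eq by (rule iffI, erule exact2, erule exE, erule exact1)
  qed
  have aug: "(1 :: ('x, 'k) mpol) \<in> homogeneous_polys (taylor_deg g 0 b)" if "b \<in> taylor_basis m 0" for b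
    using that hom_one by (simp add: basis_0 taylor_deg_def)
  have surj: "\<exists>v. (\<Sum>b\<in>taylor_basis m 0. 1 * v b) - 1 \<in> I"
    by (rule exI[of _ "\<lambda>_. 1"]) (simp add: basis_0 graded_idealD(1)[OF I])
  show ?thesis unfolding resolves_def I_def[symmetric]
    by (intro conjI allI ballI fin hom aug surj exact)
qed

end

section \<open>Minimal generators\<close>

lemma mono_pol_in_mono_ideal:
  "(mono_pol t :: ('x, 'k::comm_ring_1) mpol) \<in> mono_ideal U \<longleftrightarrow> (\<exists>u\<in>U. mono_dvd u t)"
  unfolding mono_ideal_eq by (simp add: mono_pol_def lookup_single when_def)

lemma mono_ideal_cong:
  "(\<And>t. (\<exists>u\<in>U. mono_dvd u t) \<longleftrightarrow> (\<exists>u\<in>V. mono_dvd u t)) \<Longrightarrow> mono_ideal U = mono_ideal V"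
  unfolding mono_ideal_eq by simp

lemma finite_squarefree: "finite {t :: 'x::finite mono. squarefree_mono t}"
proof (rule finite_imageD)
  show "finite (lk ` {t :: 'x mono. squarefree_mono t})"
  proof (rule finite_subset)
    show "lk ` {t :: 'x mono. squarefree_mono t} \<subseteq> PiE UNIV (\<lambda>_. {..1})"
      by (auto simp: squarefree_mono_def)
    show "finite (PiE UNIV (\<lambda>_::'x. {..1::nat}))" by (rule finite_PiE) auto
  qed
  show "inj_on lk {t :: 'x mono. squarefree_mono t}"
    by (rule inj_onI) (rule poly_mapping_eqI, simp)
qed

text \<open>The minimal generators are the generators that no other generator divides. Below every element of
\<open>U\<close> there is one of them, by induction on the degree. A set that generates minimally is an antichain
for divisibility, and two antichains of monomials with the same multiples are equal.\<close>

lemma min_gens_eq: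
  fixes U :: "'x::finite mono set"
  shows "min_gens (mono_ideal U :: ('x, 'k::comm_ring_1) mpol set)
    = {u\<in>U. \<forall>v\<in>U. mono_dvd v u \<longrightarrow> v = u}" (is "_ = ?G")
    and "(mono_ideal {u\<in>U. \<forall>v\<in>U. mono_dvd v u \<longrightarrow> v = u} :: ('x, 'k) mpol set) = mono_ideal U"
proof -
  let ?I = "mono_ideal U :: ('x, 'k) mpol set"
  have below: "\<exists>v\<in>?G. mono_dvd v u" if "u \<in> U" for u
    using that
  proof (induction "mono_deg u" arbitrary: u rule: less_induct)
    case less
    show ?case
    proof (cases "u \<in> ?G")
      case False
      then obtain v where v: "v \<in> U" "mono_dvd v u" "v \<noteq> u" using less.prems by auto
      then have "mono_deg v < mono_deg u"
        using mono_deg_mono[OF v(2)] mono_deg_eq_imp[OF v(2)] by linarith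
      from less.hyps[OF this v(1)] show ?thesis using v(2) mono_dvd_trans by blast
    qed (use mono_dvd_refl in blast)
  qed
  show G: "mono_ideal ?G = ?I"
    by (rule mono_ideal_cong) (use below mono_dvd_trans in blast)
  have gen: "(\<exists>v\<in>V. mono_dvd v t) \<longleftrightarrow> (\<exists>u\<in>?G. mono_dvd u t)" if "mono_ideal V = ?I" for V t
    using mono_pol_in_mono_ideal[of t V, where 'k = 'k] mono_pol_in_mono_ideal[of t ?G, where 'k = 'k]
    unfolding that G by simp
  have G_min: "mono_ideal V \<noteq> ?I" if V: "V \<subset> ?G" for V
  proof
    assume eq: "mono_ideal V = ?I"
    obtain u where u: "u \<in> ?G" "u \<notin> V" using V by blast
    then obtain v where v: "v \<in> V" "mono_dvd v u" using gen[OF eq, of u] mono_dvd_refl by blast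
    then have "v = u" using u V by blast
    then show False using u v by simp
  qed
  have V_eq: "V = ?G" if V: "minimally_generates V ?I" for V
  proof -
    have eq: "mono_ideal V = ?I" and min: "\<And>W. W \<subset> V \<Longrightarrow> mono_ideal W \<noteq> ?I"
      using V by (simp_all add: minimally_generates_def)
    have anti: "v' = v" if v: "v \<in> V" "v' \<in> V" "mono_dvd v' v" for v v'
    proof (rule ccontr)
      assume ne: "v' \<noteq> v"
      have "mono_ideal (V - {v}) = (mono_ideal V :: ('x, 'k) mpol set)"
      proof (rule mono_ideal_cong)
        fix t
        show "(\<exists>u\<in>V - {v}. mono_dvd u t) \<longleftrightarrow> (\<exists>u\<in>V. mono_dvd u t)"
        proof
          assume "\<exists>u\<in>V. mono_dvd u t"
          then obtain u where u: "u \<in> V" "mono_dvd u t" ..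
          show "\<exists>u\<in>V - {v}. mono_dvd u t"
          proof (cases "u = v")
            case True
            then show ?thesis using v ne u mono_dvd_trans[OF v(3), of t] by (intro bexI[of _ v']) simp_all
          qed (use u in blast)
        qed blast
      qed
      moreover have "V - {v} \<subset> V" using v(1) by blast
      ultimately show False using min[of "V - {v}"] eq by simp
    qed
    have sub: "V \<subseteq> ?G"
    proof
      fix v assume v: "v \<in> V"
      obtain u where u: "u \<in> ?G" "mono_dvd u v" using gen[OF eq, of v] v mono_dvd_refl by blast
      obtain v' where v': "v' \<in> V" "mono_dvd v' u" using gen[OF eq, of u] u(1) mono_dvd_refl by blast
      have "v' = v" by (rule anti[OF v v'(1) mono_dvd_trans[OF v'(2) u(2)]])
      then have "u = v" using v'(2) u(2) mono_dvd_antisym by simp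
      then show "v \<in> ?G" using u(1) by simp
    qed
    show "V = ?G"
    proof (rule ccontr)
      assume "V \<noteq> ?G"
      then have "V \<subset> ?G" using sub by (rule psubsetI[rotated])
      then show False using G_min eq by blast
    qed
  qed
  have "minimally_generates ?G ?I" unfolding minimally_generates_def using G G_min by simp
  then show "min_gens ?I = ?G" unfolding min_gens_def using V_eq by (rule the_equality)
qed

lemma squarefree_min_gens:
  fixes I :: "('x::finite, 'k::comm_ring_1) mpol set"
  assumes "squarefree_monomial_ideal I"
  shows "finite (min_gens I)" "mono_ideal (min_gens I) = I"
proof -
  obtain U where U: "\<forall>u\<in>U. squarefree_mono u" "I = mono_ideal U"
    using assms unfolding squarefree_monomial_ideal_def by blast
  have "min_gens I \<subseteq> {t. squarefree_mono t}" unfolding U(2) min_gens_eq(1) using U(1) by blast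
  then show "finite (min_gens I)" by (rule finite_subset[OF _ finite_squarefree])
  show "mono_ideal (min_gens I) = I" unfolding U(2) min_gens_eq(1) by (rule min_gens_eq(2))
qed

section \<open>Minimal resolutions of the quotient module\<close>

lemma vec_in_image_iff:
  fixes A :: "'r::comm_ring_1 mat"
  assumes A: "A \<in> carrier_mat n k"
  shows "vec n v \<in> (*\<^sub>v) A ` carrier_vec k \<longleftrightarrow> (\<exists>y. \<forall>a<n. v a = (\<Sum>b<k. A $$ (a, b) * y b))"
proof
  assume "vec n v \<in> (*\<^sub>v) A ` carrier_vec k"
  then obtain w where w: "w \<in> carrier_vec k" "vec n v = A *\<^sub>v w" by blast
  have "v a = (\<Sum>b<k. A $$ (a, b) * w $ b)" if "a < n" for a
  proof -
    have "v a = (A *\<^sub>v w) $ a" using w(2)[symmetric] that by simp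
    then show ?thesis using A w that by (simp add: scalar_prod_def atLeast0LessThan)
  qed
  then show "\<exists>y. \<forall>a<n. v a = (\<Sum>b<k. A $$ (a, b) * y b)"
    by (intro exI[of _ "\<lambda>b. w $ b"] allI impI)
next
  assume "\<exists>y. \<forall>a<n. v a = (\<Sum>b<k. A $$ (a, b) * y b)"
  then obtain y where y: "\<forall>a<n. v a = (\<Sum>b<k. A $$ (a, b) * y b)" ..
  have "vec n v = A *\<^sub>v vec k y"
    using A y by (intro eq_vecI) (simp_all add: scalar_prod_def atLeast0LessThan)
  then show "vec n v \<in> (*\<^sub>v) A ` carrier_vec k" by (rule image_eqI) simp
qed

lemma vec_in_kernel_iff:
  fixes A :: "'r::comm_ring_1 mat"
  assumes A: "A \<in> carrier_mat n k"
  shows "vec k v \<in> mat_kernel A \<longleftrightarrow> (\<forall>a<n. (\<Sum>b<k. A $$ (a, b) * v b) = 0)"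
  using A by (auto simp: mat_kernel_def vec_eq_iff scalar_prod_def atLeast0LessThan)

lemma vec_sets_eq_iff:
  assumes "S \<subseteq> carrier_vec n" "T \<subseteq> carrier_vec n"
  shows "S = T \<longleftrightarrow> (\<forall>v. vec n v \<in> S \<longleftrightarrow> vec n v \<in> T)"
proof
  assume eq: "\<forall>v. vec n v \<in> S \<longleftrightarrow> vec n v \<in> T"
  have "w \<in> S \<longleftrightarrow> w \<in> T" if "w \<in> carrier_vec n" for w
  proof -
    have "vec n (\<lambda>i. w $ i) = w" using that by (intro eq_vecI) auto
    then show ?thesis using eq[rule_format, of "\<lambda>i. w $ i"] by simp
  qed
  then show "S = T" using assms by blast
qed simp

lemma all_nat_iff: "(\<forall>i. P i) \<longleftrightarrow> P 0 \<and> (\<forall>i. P (Suc i))"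
proof
  assume R: "P 0 \<and> (\<forall>i. P (Suc i))"
  show "\<forall>i. P i"
  proof
    fix i show "P i" using R by (cases i) simp_all
  qed
qed simp

lemma resolves_cong:
  assumes "\<And>i a b. a \<in> B i \<Longrightarrow> b \<in> B (Suc i) \<Longrightarrow> D i a b = D' i a b"
  shows "resolves I B dg D f \<longleftrightarrow> resolves I B dg D' f"
proof -
  have app: "(\<Sum>b\<in>B (Suc i). D i a b * v b) = (\<Sum>b\<in>B (Suc i). D' i a b * v b)" if "a \<in> B i" for i a v
    using assms[OF that] by (intro sum.cong) simp_all
  have cyc: "cycle I B D f i v \<longleftrightarrow> cycle I B D' f i v" for i v
  proof (cases i)
    case (Suc j)
    show ?thesis unfolding Suc cycle_Suc by (intro ball_cong refl) (simp only: app)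
  qed (simp add: cycle_0)
  have im: "(\<forall>a\<in>B i. v a = (\<Sum>b\<in>B (Suc i). D i a b * y b))
      \<longleftrightarrow> (\<forall>a\<in>B i. v a = (\<Sum>b\<in>B (Suc i). D' i a b * y b))" for i v y
    by (intro ball_cong refl) (simp only: app)
  have hom: "(\<forall>i. \<forall>a\<in>B i. \<forall>b\<in>B (Suc i). D i a b \<in> homogeneous_polys (dg (Suc i) b - dg i a))
      \<longleftrightarrow> (\<forall>i. \<forall>a\<in>B i. \<forall>b\<in>B (Suc i). D' i a b \<in> homogeneous_polys (dg (Suc i) b - dg i a))"
    by (intro all_cong1 ball_cong refl) (simp only: assms)
  show ?thesis unfolding resolves_def cyc im hom ..
qed

context
  fixes I :: "('x::finite, 'k::field) mpol set"
  assumes I: "graded_ideal I"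
begin

abbreviation cls :: "('x, 'k) mpol \<Rightarrow> ('x, 'k) mpol set" where "cls f \<equiv> I +>\<^bsub>poly_ring\<^esub> f"

lemma cls_eq: "cls f = (\<lambda>h. h + f) ` I"
  by (auto simp: a_r_coset_def')

lemma cls_eq_iff: "cls f = cls h \<longleftrightarrow> f - h \<in> I"
proof
  assume "cls f = cls h"
  moreover have "f \<in> cls f" using graded_idealD(1)[OF I] by (force simp: cls_eq)
  ultimately obtain p where "p \<in> I" "f = p + h" by (auto simp: cls_eq)
  then show "f - h \<in> I" by simp
next
  assume fh: "f - h \<in> I"
  have "p + f \<in> (\<lambda>q. q + h) ` I" if "p \<in> I" for p
    using graded_idealD(2)[OF I that fh] by (intro image_eqI[of _ _ "p + (f - h)"]) simp_all
  moreover have "p + h \<in> (\<lambda>q. q + f) ` I" if "p \<in> I" for p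
    using graded_idealD(7)[OF I that fh] by (intro image_eqI[of _ _ "p - (f - h)"]) simp_all
  ultimately show "cls f = cls h" unfolding cls_eq by blast
qed

lemma graded_ideal_imp_ideal: "ideal I poly_ring"
proof (rule idealI)
  show "ring (poly_ring :: ('x, 'k) mpol ring)" by (rule class_ring.ring_axioms)
  show "subgroup I (add_monoid poly_ring)"
  proof (rule subgroup.intro)
    fix x assume x: "x \<in> I"
    have "inv\<^bsub>add_monoid poly_ring\<^esub> x = - x"
      by (simp only: a_inv_def[symmetric] class_ring_simps(8))
    then show "inv\<^bsub>add_monoid poly_ring\<^esub> x \<in> I" using graded_idealD(6)[OF I x] by simp
  qed (use graded_idealD(1,2)[OF I] in simp_all)
qed (use graded_idealD(3,4)[OF I] in simp_all)

lemma quot_module_simps: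
  "carrier (quot_module I) = range cls"
  "\<zero>\<^bsub>quot_module I\<^esub> = cls 0"
  "cls f \<oplus>\<^bsub>quot_module I\<^esub> cls h = cls (f + h)"
  "p \<odot>\<^bsub>quot_module I\<^esub> cls f = cls (p * f)"
proof -
  have z: "cls 0 = I" by (simp add: cls_eq)
  show "carrier (quot_module I) = range cls"
    by (simp add: quot_module_def ring.defs module.defs FactRing_def A_RCOSETS_def' full_SetCompr_eq) blast
  show "\<zero>\<^bsub>quot_module I\<^esub> = cls 0"
    by (simp add: quot_module_def ring.defs module.defs FactRing_def z)
  show "cls f \<oplus>\<^bsub>quot_module I\<^esub> cls h = cls (f + h)"
    using ideal.a_rcos_sum[OF graded_ideal_imp_ideal, of f h]
    by (simp add: quot_module_def ring.defs module.defs FactRing_def)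
  show "p \<odot>\<^bsub>quot_module I\<^esub> cls f = cls (p * f)"
    using ideal.rcoset_mult_add[OF graded_ideal_imp_ideal, of p f]
    by (simp add: quot_module_def ring.defs module.defs FactRing_def)
qed

lemma abelian_monoid_quot: "abelian_monoid (quot_module I)"
proof (rule abelian_monoidI)
  show "x \<oplus>\<^bsub>quot_module I\<^esub> y \<in> carrier (quot_module I)"
    if "x \<in> carrier (quot_module I)" "y \<in> carrier (quot_module I)" for x y
    using that unfolding quot_module_simps(1) by (elim rangeE) (simp add: quot_module_simps(3))
  show "\<zero>\<^bsub>quot_module I\<^esub> \<in> carrier (quot_module I)"
    unfolding quot_module_simps(1,2) by (rule rangeI)
  show "x \<oplus>\<^bsub>quot_module I\<^esub> y \<oplus>\<^bsub>quot_module I\<^esub> z = x \<oplus>\<^bsub>quot_module I\<^esub> (y \<oplus>\<^bsub>quot_module I\<^esub> z)"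
    if "x \<in> carrier (quot_module I)" "y \<in> carrier (quot_module I)" "z \<in> carrier (quot_module I)" for x y z
    using that unfolding quot_module_simps(1) by (elim rangeE) (simp add: quot_module_simps(3) add.assoc)
  show "\<zero>\<^bsub>quot_module I\<^esub> \<oplus>\<^bsub>quot_module I\<^esub> x = x" if "x \<in> carrier (quot_module I)" for x
    using that unfolding quot_module_simps(1,2) by (elim rangeE) (simp add: quot_module_simps(3))
  show "x \<oplus>\<^bsub>quot_module I\<^esub> y = y \<oplus>\<^bsub>quot_module I\<^esub> x"
    if "x \<in> carrier (quot_module I)" "y \<in> carrier (quot_module I)" for x y
    using that unfolding quot_module_simps(1) by (elim rangeE) (simp add: quot_module_simps(3) add.commute)
qed

lemma finsum_quot:
  assumes "finite A"
  shows "finsum (quot_module I) (\<lambda>b. cls (h b)) A = cls (\<Sum>b\<in>A. h b)"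
proof -
  interpret M: abelian_monoid "quot_module I" by (rule abelian_monoid_quot)
  have in_carrier: "(\<lambda>b. cls (h b)) \<in> S \<rightarrow> carrier (quot_module I)" for S
    unfolding quot_module_simps(1) by blast
  show ?thesis using assms
  proof (induction A rule: finite_induct)
    case empty
    show ?case unfolding M.finsum_empty sum.empty by (rule quot_module_simps(2))
  next
    case (insert a A)
    have "finsum (quot_module I) (\<lambda>b. cls (h b)) (insert a A)
        = cls (h a) \<oplus>\<^bsub>quot_module I\<^esub> finsum (quot_module I) (\<lambda>b. cls (h b)) A"
      by (rule M.finsum_insert[OF insert.hyps in_carrier]) (simp add: quot_module_simps(1))
    then show ?case using insert by (simp add: quot_module_simps(3))
  qed
qed

lemma aug_map_eq:
  assumes "\<And>b. b < rank F 0 \<Longrightarrow> aug F b = cls (f b)"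
  shows "aug_map (quot_module I) F v = cls (\<Sum>b<rank F 0. f b * v $ b)"
proof -
  interpret M: abelian_monoid "quot_module I" by (rule abelian_monoid_quot)
  have "aug_map (quot_module I) F v = finsum (quot_module I) (\<lambda>b. cls (f b * v $ b)) {..<rank F 0}"
    unfolding aug_map_def
  proof (rule M.finsum_cong')
    show "v $ b \<odot>\<^bsub>quot_module I\<^esub> aug F b = cls (f b * v $ b)" if "b \<in> {..<rank F 0}" for b
      using assms that by (simp add: quot_module_simps(4) mult.commute)
  qed (auto simp: quot_module_simps(1))
  then show ?thesis by (simp only: finsum_quot[OF finite_lessThan])
qed

text \<open>Vectors of the matrix library with \<open>n\<close> entries correspond to functions on the indices below \<open>n\<close>, and
the augmentation is computed in \<open>S\<close> through representatives of the classes \<open>aug F b\<close>.\<close>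

lemma graded_free_resolution_iff:
  assumes aug: "\<And>b. b < rank F 0 \<Longrightarrow> aug F b = cls (f b)"
    and f: "\<And>b. b < rank F 0 \<Longrightarrow> f b \<in> homogeneous_polys (shift F 0 b)"
    and dim: "\<And>i. bdry F i \<in> carrier_mat (rank F i) (rank F (Suc i))"
  shows "graded_free_resolution (quot_module I) (quot_grading I) F
    \<longleftrightarrow> resolves I (\<lambda>i. {..<rank F i}) (shift F) (\<lambda>i a b. bdry F i $$ (a, b)) f"
proof -
  let ?cyc = "cycle I (\<lambda>i. {..<rank F i}) (\<lambda>i a b. bdry F i $$ (a, b)) f"
  let ?im = "\<lambda>i v. \<exists>y. \<forall>a\<in>{..<rank F i}. v a = (\<Sum>b<rank F (Suc i). bdry F i $$ (a, b) * y b)"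
  have im: "vec (rank F i) v \<in> (*\<^sub>v) (bdry F i) ` carrier_vec (rank F (Suc i)) \<longleftrightarrow> ?im i v" for i v
    using vec_in_image_iff[OF dim, of i v] by (simp add: Ball_def)
  have im_sub: "(*\<^sub>v) (bdry F i) ` carrier_vec (rank F (Suc i)) \<subseteq> carrier_vec (rank F i)" for i
    using dim[of i] by auto
  have ker: "vec (rank F (Suc i)) v \<in> mat_kernel (bdry F i) \<longleftrightarrow> ?cyc (Suc i) v" for i v
    using vec_in_kernel_iff[OF dim, of i v] by (simp add: cycle_Suc Ball_def)
  have ker_sub: "mat_kernel (bdry F i) \<subseteq> carrier_vec (rank F (Suc i))" for i
    using dim[of i] by (auto simp: mat_kernel_def)
  have am: "aug_map (quot_module I) F v = cls (\<Sum>b<rank F 0. f b * v $ b)" for v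
    by (rule aug_map_eq) (rule aug)
  have zero: "aug_map (quot_module I) F v = \<zero>\<^bsub>quot_module I\<^esub> \<longleftrightarrow> (\<Sum>b<rank F 0. f b * v $ b) \<in> I" for v
    unfolding am quot_module_simps(2) cls_eq_iff by simp
  have aug0: "vec (rank F 0) v \<in> {v \<in> carrier_vec (rank F 0). aug_map (quot_module I) F v = \<zero>\<^bsub>quot_module I\<^esub>}
      \<longleftrightarrow> ?cyc 0 v" for v
  proof -
    have "(\<Sum>b<rank F 0. f b * vec (rank F 0) v $ b) = (\<Sum>b<rank F 0. f b * v b)"
      by (intro sum.cong) auto
    then show ?thesis unfolding mem_Collect_eq zero cycle_0 by simp
  qed
  have exact0: "{v \<in> carrier_vec (rank F 0). aug_map (quot_module I) F v = \<zero>\<^bsub>quot_module I\<^esub>}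
      = (*\<^sub>v) (bdry F 0) ` carrier_vec (rank F 1) \<longleftrightarrow> (\<forall>v. ?cyc 0 v \<longleftrightarrow> ?im 0 v)"
    unfolding One_nat_def by (subst vec_sets_eq_iff[OF _ im_sub]) (simp_all only: aug0 im, blast)
  have exactS: "mat_kernel (bdry F i) = (*\<^sub>v) (bdry F (Suc i)) ` carrier_vec (rank F (Suc (Suc i)))
      \<longleftrightarrow> (\<forall>v. ?cyc (Suc i) v \<longleftrightarrow> ?im (Suc i) v)" for i
    by (subst vec_sets_eq_iff[OF ker_sub im_sub]) (simp only: ker im)
  have exact: "(\<forall>i v. ?cyc i v \<longleftrightarrow> ?im i v)
      \<longleftrightarrow> (\<forall>v. ?cyc 0 v \<longleftrightarrow> ?im 0 v) \<and> (\<forall>i. \<forall>v. ?cyc (Suc i) v \<longleftrightarrow> ?im (Suc i) v)"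
    (is "(\<forall>i. ?P i) \<longleftrightarrow> _") by (rule all_nat_iff)
  have surj: "aug_map (quot_module I) F ` carrier_vec (rank F 0) = carrier (quot_module I)
      \<longleftrightarrow> (\<exists>v. (\<Sum>b<rank F 0. f b * v b) - 1 \<in> I)"
  proof
    assume "aug_map (quot_module I) F ` carrier_vec (rank F 0) = carrier (quot_module I)"
    then have "cls 1 \<in> aug_map (quot_module I) F ` carrier_vec (rank F 0)"
      unfolding quot_module_simps(1) by simp
    then obtain w where "aug_map (quot_module I) F w = cls 1" by (elim imageE) simp
    then have "(\<Sum>b<rank F 0. f b * w $ b) - 1 \<in> I" unfolding am cls_eq_iff .
    then show "\<exists>v. (\<Sum>b<rank F 0. f b * v b) - 1 \<in> I" by (rule exI[of _ "\<lambda>b. w $ b"])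
  next
    assume "\<exists>v. (\<Sum>b<rank F 0. f b * v b) - 1 \<in> I"
    then obtain v where v: "(\<Sum>b<rank F 0. f b * v b) - 1 \<in> I" ..
    have "cls p \<in> aug_map (quot_module I) F ` carrier_vec (rank F 0)" for p
    proof (rule image_eqI)
      let ?w = "vec (rank F 0) (\<lambda>b. v b * p)"
      show "?w \<in> carrier_vec (rank F 0)" by simp
      have "(\<Sum>b<rank F 0. f b * ?w $ b) = (\<Sum>b<rank F 0. f b * v b) * p"
        by (simp add: sum_distrib_right mult.assoc)
      then have "p - (\<Sum>b<rank F 0. f b * ?w $ b) = - (((\<Sum>b<rank F 0. f b * v b) - 1) * p)"
        by (simp add: left_diff_distrib)
      also have "\<dots> \<in> I" by (rule graded_idealD(6)[OF I graded_idealD(4)[OF I v]])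
      finally show "cls p = aug_map (quot_module I) F ?w" unfolding am cls_eq_iff .
    qed
    moreover have "aug_map (quot_module I) F w \<in> range cls" for w unfolding am by (rule rangeI)
    ultimately show "aug_map (quot_module I) F ` carrier_vec (rank F 0) = carrier (quot_module I)"
      unfolding quot_module_simps(1) by (intro subset_antisym subsetI) (elim imageE rangeE, simp)+
  qed
  have hom: "(\<forall>i. \<forall>a<rank F i. \<forall>b<rank F (Suc i).
        bdry F i $$ (a, b) \<in> homogeneous_polys (shift F (Suc i) b - shift F i a))
      \<longleftrightarrow> (\<forall>i. \<forall>a\<in>{..<rank F i}. \<forall>b\<in>{..<rank F (Suc i)}.
        bdry F i $$ (a, b) \<in> homogeneous_polys (shift F (Suc i) b - shift F i a))"
    by (simp add: Ball_def)
  have augG: "(\<forall>b<rank F 0. aug F b \<in> quot_grading I (shift F 0 b)) \<longleftrightarrow> True"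
    using aug f by (simp add: quot_grading_def)
  have f': "(\<forall>b\<in>{..<rank F 0}. f b \<in> homogeneous_polys (shift F 0 b)) \<longleftrightarrow> True"
    using f by simp
  have dim': "(\<forall>i. bdry F i \<in> carrier_mat (rank F i) (rank F (Suc i))) \<longleftrightarrow> True"
    using dim by simp
  show ?thesis
    unfolding graded_free_resolution_def resolves_def exact exact0 exactS surj hom augG f' dim'
    by (simp only: simp_thms finite_lessThan)
qed

lemma resolution_of_graded_free_resolution:
  assumes F: "graded_free_resolution (quot_module I) (quot_grading I) F"
  shows "\<exists>f. resolves I (\<lambda>i. {..<rank F i}) (shift F) (\<lambda>i a b. bdry F i $$ (a, b)) f"
proof -
  have dim: "bdry F i \<in> carrier_mat (rank F i) (rank F (Suc i))" for i
    using F unfolding graded_free_resolution_def by simp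
  have "\<forall>b\<in>{..<rank F 0}. \<exists>p. p \<in> homogeneous_polys (shift F 0 b) \<and> aug F b = cls p"
  proof
    fix b assume "b \<in> {..<rank F 0}"
    then have "aug F b \<in> quot_grading I (shift F 0 b)"
      using F unfolding graded_free_resolution_def by simp
    then show "\<exists>p. p \<in> homogeneous_polys (shift F 0 b) \<and> aug F b = cls p"
      unfolding quot_grading_def by (elim imageE) (rule exI, rule conjI)
  qed
  from bchoice[OF this] obtain f
    where f: "\<forall>b\<in>{..<rank F 0}. f b \<in> homogeneous_polys (shift F 0 b) \<and> aug F b = cls (f b)" ..
  have "resolves I (\<lambda>i. {..<rank F i}) (shift F) (\<lambda>i a b. bdry F i $$ (a, b)) f"
  proof (rule iffD1[OF graded_free_resolution_iff F])
    show "aug F b = cls (f b)" if "b < rank F 0" for b using f that by simp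
    show "f b \<in> homogeneous_polys (shift F 0 b)" if "b < rank F 0" for b using f that by simp
    show "bdry F i \<in> carrier_mat (rank F i) (rank F (Suc i))" for i by (rule dim)
  qed
  then show ?thesis by (rule exI[of _ f])
qed

text \<open>Betti numbers refer to resolutions whose bases are indexed by initial segments of the natural
numbers, so a resolution obtained from the Taylor resolution has to be enumerated.\<close>

lemma resolves_reindex:
  fixes e :: "nat \<Rightarrow> nat \<Rightarrow> 'b" and n :: "nat \<Rightarrow> nat"
  assumes res: "resolves I B dg D f" and e: "\<And>i. bij_betw (e i) {..<n i} (B i)"
  shows "resolves I (\<lambda>i. {..<n i}) (\<lambda>i a. dg i (e i a)) (\<lambda>i a b. D i (e i a) (e (Suc i) b)) (\<lambda>b. f (e 0 b))"
    (is "resolves I ?N ?dg ?D ?f")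
proof -
  define e' where "e' i = the_inv_into {..<n i} (e i)" for i
  have inj: "inj_on (e i) {..<n i}" and surj: "e i ` {..<n i} = B i" for i
    using e[of i] by (simp_all add: bij_betw_def)
  have e_in: "e i a \<in> B i" if "a < n i" for i a using surj[of i] that by blast
  have e'_e: "e' i (e i a) = a" if "a < n i" for i a
    unfolding e'_def by (rule the_inv_into_f_f[OF inj]) (use that in simp)
  have e_e': "e i (e' i a) = a" if "a \<in> B i" for i a
    unfolding e'_def by (rule f_the_inv_into_f_bij_betw[OF e that])
  have e'_in: "e' i a < n i" if "a \<in> B i" for i a
    using the_inv_into_into[OF inj[of i], of a "{..<n i}"] surj[of i] that by (simp add: e'_def)
  have sum_e: "(\<Sum>b<n i. h (e i b)) = (\<Sum>b\<in>B i. h b)" for i and h :: "_ \<Rightarrow> ('x, 'k) mpol"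
    by (rule sum.reindex_bij_betw[OF e])
  have sum_e': "(\<Sum>b<n i. h (e i b) * v b) = (\<Sum>b\<in>B i. h b * v (e' i b))" for i h and v :: "nat \<Rightarrow> ('x, 'k) mpol"
  proof -
    have "(\<Sum>b<n i. h (e i b) * v b) = (\<Sum>b<n i. h (e i b) * v (e' i (e i b)))"
      by (intro sum.cong refl) (simp add: e'_e)
    then show ?thesis using sum_e[where i = i and h = "\<lambda>b. h b * v (e' i b)"] by simp
  qed
  have all_e: "(\<forall>a\<in>{..<n i}. P (e i a)) \<longleftrightarrow> (\<forall>a\<in>B i. P a)" for i P
    unfolding surj[of i, symmetric] by simp
  have cyc: "cycle I ?N ?D ?f i v \<longleftrightarrow> cycle I B D f i (\<lambda>b. v (e' i b))" for i v
  proof (cases i)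
    case 0
    show ?thesis unfolding 0 cycle_0 sum_e' ..
  next
    case (Suc j)
    show ?thesis unfolding Suc cycle_Suc sum_e' by (rule all_e)
  qed
  have im: "(\<exists>y. \<forall>a\<in>{..<n i}. v a = (\<Sum>b<n (Suc i). ?D i a b * y b))
      \<longleftrightarrow> (\<exists>y. \<forall>a\<in>B i. v (e' i a) = (\<Sum>b\<in>B (Suc i). D i a b * y b))" for i v
  proof
    assume "\<exists>y. \<forall>a\<in>{..<n i}. v a = (\<Sum>b<n (Suc i). ?D i a b * y b)"
    then obtain y where y: "\<forall>a\<in>{..<n i}. v a = (\<Sum>b<n (Suc i). ?D i a b * y b)" ..
    have "v (e' i a) = (\<Sum>b\<in>B (Suc i). D i a b * y (e' (Suc i) b))" if a: "a \<in> B i" for a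
      using y[rule_format, of "e' i a"] e'_in[OF a] e_e'[OF a] unfolding sum_e' by simp
    then show "\<exists>y. \<forall>a\<in>B i. v (e' i a) = (\<Sum>b\<in>B (Suc i). D i a b * y b)"
      by (intro exI[of _ "\<lambda>b. y (e' (Suc i) b)"] ballI)
  next
    assume "\<exists>y. \<forall>a\<in>B i. v (e' i a) = (\<Sum>b\<in>B (Suc i). D i a b * y b)"
    then obtain y where y: "\<forall>a\<in>B i. v (e' i a) = (\<Sum>b\<in>B (Suc i). D i a b * y b)" ..
    have "v a = (\<Sum>b<n (Suc i). ?D i a b * y (e (Suc i) b))" if a: "a \<in> {..<n i}" for a
    proof -
      have "v (e' i (e i a)) = (\<Sum>b\<in>B (Suc i). D i (e i a) b * y b)"
        using y e_in[of a i] a by simp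
      also have "\<dots> = (\<Sum>b<n (Suc i). ?D i a b * y (e (Suc i) b))"
        by (rule sum_e[symmetric])
      finally show ?thesis using e'_e[of a i] a by simp
    qed
    then show "\<exists>y. \<forall>a\<in>{..<n i}. v a = (\<Sum>b<n (Suc i). ?D i a b * y b)"
      by (intro exI[of _ "\<lambda>b. y (e (Suc i) b)"] ballI)
  qed
  obtain v where v: "(\<Sum>b\<in>B 0. f b * v b) - 1 \<in> I" using res_surj[OF I res] ..
  have surj': "\<exists>v. (\<Sum>b<n 0. ?f b * v b) - 1 \<in> I"
    by (rule exI[of _ "\<lambda>b. v (e 0 b)"]) (use v sum_e[where i = 0 and h = "\<lambda>b. f b * v b"] in simp)
  have hom: "?D i a b \<in> homogeneous_polys (?dg (Suc i) b - ?dg i a)"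
    if "a \<in> {..<n i}" "b \<in> {..<n (Suc i)}" for i a b
    by (rule res_hom[OF I res]) (use that e_in in auto)
  have hom_f: "?f b \<in> homogeneous_polys (?dg 0 b)" if "b \<in> {..<n 0}" for b
    by (rule res_hom_aug[OF I res]) (use that e_in in auto)
  have exact: "cycle I ?N ?D ?f i v \<longleftrightarrow> (\<exists>y. \<forall>a\<in>{..<n i}. v a = (\<Sum>b<n (Suc i). ?D i a b * y b))" for i v
    unfolding cyc im by (rule res_exact[OF I res])
  show ?thesis unfolding resolves_def
    by (intro conjI allI ballI finite_lessThan hom hom_f surj' exact)
qed

text \<open>Graded Betti numbers are read off from some minimal graded free resolution, so they carry
information only once such a resolution is known to exist.\<close>

theorem minimal_graded_free_resolution_exists:
  assumes res: "resolves I B dg D f" and fin: "finite (SIGMA i:UNIV. B i)"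
  shows "\<exists>F. minimal_graded_free_resolution (quot_module I) (quot_grading I) F"
proof -
  obtain C E where C: "resolves I C dg E f" and min: "minimal_maps C E"
    using minimal_resolution_exists[OF I res fin] by blast
  define n where "n i = card (C i)" for i
  have "\<forall>i. \<exists>h. bij_betw h {..<n i} (C i)"
    using ex_bij_betw_nat_finite[OF res_finite[OF I C]] by (simp add: n_def atLeast0LessThan)
  from choice[OF this] obtain e where e: "\<forall>i. bij_betw (e i) {..<n i} (C i)" ..
  have e_in: "e i a \<in> C i" if "a < n i" for i a
    using bij_betwE[OF e[rule_format, of i]] that by simp
  define F where "F = \<lparr>rank = n, shift = (\<lambda>i a. dg i (e i a)),
    bdry = (\<lambda>i. mat (n i) (n (Suc i)) (\<lambda>(a, b). E i (e i a) (e (Suc i) b))),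
    aug = (\<lambda>b. cls (f (e 0 b)))\<rparr>"
  have F: "rank F = n" "shift F = (\<lambda>i a. dg i (e i a))" "aug F = (\<lambda>b. cls (f (e 0 b)))"
    "bdry F i \<in> carrier_mat (n i) (n (Suc i))" for i
    by (simp_all add: F_def)
  have bdry: "bdry F i $$ (a, b) = E i (e i a) (e (Suc i) b)" if "a < n i" "b < n (Suc i)" for i a b
    using that by (simp add: F_def)
  have "resolves I (\<lambda>i. {..<rank F i}) (shift F) (\<lambda>i a b. bdry F i $$ (a, b)) (\<lambda>b. f (e 0 b))
    \<longleftrightarrow> resolves I (\<lambda>i. {..<n i}) (\<lambda>i a. dg i (e i a)) (\<lambda>i a b. E i (e i a) (e (Suc i) b)) (\<lambda>b. f (e 0 b))"
    unfolding F by (rule resolves_cong) (simp add: bdry)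
  then have "resolves I (\<lambda>i. {..<rank F i}) (shift F) (\<lambda>i a b. bdry F i $$ (a, b)) (\<lambda>b. f (e 0 b))"
    using resolves_reindex[OF C, of e n] e by simp
  then have "graded_free_resolution (quot_module I) (quot_grading I) F"
  proof (rule iffD2[OF graded_free_resolution_iff, rotated 3])
    show "aug F b = cls (f (e 0 b))" for b by (simp add: F)
    show "f (e 0 b) \<in> homogeneous_polys (shift F 0 b)" if "b < rank F 0" for b
      using res_hom_aug[OF I C e_in] that by (simp add: F)
    show "bdry F i \<in> carrier_mat (rank F i) (rank F (Suc i))" for i using F(4) by (simp add: F(1))
  qed
  moreover have "lk (bdry F i $$ (a, b)) 0 = 0" if "a < rank F i" "b < rank F (Suc i)" for i a b
    using min e_in that by (simp add: bdry F(1) minimal_maps_def)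
  ultimately show ?thesis unfolding minimal_graded_free_resolution_def by (intro exI[of _ F]) simp
qed

end

section \<open>Regularity and cosize\<close>

text \<open>As long as \<open>lcm U\<close> differs from \<open>lcm G\<close>, some element of \<open>G\<close> does not divide it, and adding that
element to \<open>U\<close> raises the degree of the least common multiple by at least one.\<close>

lemma extend_to_full_lcm:
  assumes G: "finite G" and U: "U \<subseteq> G"
  shows "\<exists>V. U \<subseteq> V \<and> V \<subseteq> G \<and> mono_lcm V = mono_lcm G
    \<and> card V + mono_deg (mono_lcm U) \<le> card U + mono_deg (mono_lcm G)"
  using U
proof (induction "mono_deg (mono_lcm G) - mono_deg (mono_lcm U)" arbitrary: U rule: less_induct)
  case less
  have finU: "finite U" using less.prems G finite_subset by blast
  show ?case
  proof (cases "mono_lcm U = mono_lcm G")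
    case True
    then show ?thesis using less.prems by (intro exI[of _ U]) simp
  next
    case False
    have UG: "mono_dvd (mono_lcm U) (mono_lcm G)" by (rule mono_lcm_mono[OF G less.prems])
    then have "\<not> mono_dvd (mono_lcm G) (mono_lcm U)" using False mono_dvd_antisym by blast
    then obtain u where u: "u \<in> G" "\<not> mono_dvd u (mono_lcm U)" using mono_lcm_dvd_iff[OF G] by blast
    let ?U = "insert u U"
    have sub: "?U \<subseteq> G" using u less.prems by simp
    have le: "mono_dvd (mono_lcm U) (mono_lcm ?U)" by (rule mono_lcm_mono) (use finU in auto)
    have le': "mono_dvd (mono_lcm ?U) (mono_lcm G)" by (rule mono_lcm_mono[OF G sub])
    have "mono_dvd u (mono_lcm ?U)" by (rule dvd_mono_lcm) (use finU in auto)
    then have "mono_lcm U \<noteq> mono_lcm ?U" using u(2) by metis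
    then have lt: "mono_deg (mono_lcm U) < mono_deg (mono_lcm ?U)"
      using mono_deg_mono[OF le] mono_deg_eq_imp[OF le] by linarith
    have "mono_deg (mono_lcm G) - mono_deg (mono_lcm ?U) < mono_deg (mono_lcm G) - mono_deg (mono_lcm U)"
      using lt mono_deg_mono[OF le'] by linarith
    from less.hyps[OF this sub] obtain V where V: "?U \<subseteq> V" "V \<subseteq> G" "mono_lcm V = mono_lcm G"
      "card V + mono_deg (mono_lcm ?U) \<le> card ?U + mono_deg (mono_lcm G)" by blast
    have "card ?U \<le> Suc (card U)" by (rule card_insert_le_m1) simp_all
    then have "card V + mono_deg (mono_lcm U) \<le> card U + mono_deg (mono_lcm G)"
      using V(4) lt by linarith
    then show ?thesis using V by (intro exI[of _ V]) simp
  qed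
qed

text \<open>Suppose that all sets with at least \<open>w\<close> elements have the same least common multiple. Between such sets
the entries of the Taylor matrices are signs, so the equation \<open>eq\<close> says that the face \<open>\<sigma>\<close> is the
simplicial boundary of the chain \<open>z\<close>. This is impossible, because the boundary of \<open>\<sigma>\<close> is not \<open>0\<close>.\<close>

lemma taylor_top_class:
  fixes z :: "nat set \<Rightarrow> 'k::field"
  assumes w: "0 < w" and \<sigma>: "\<sigma> \<in> taylor_basis m w"
    and full: "\<And>A. A \<subseteq> {..<m} \<Longrightarrow> w \<le> card A \<Longrightarrow> mono_lcm (g ` A) = L"
    and eq: "\<forall>a\<in>taylor_basis m w. (if a = \<sigma> then 1 else 0)
      = (\<Sum>b\<in>taylor_basis m (Suc w). lk (taylor g w a b :: ('x::finite, 'k) mpol) 0 * z b)"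
  shows False
proof -
  have fin: "finite \<sigma>" "\<sigma> \<subseteq> {..<m}" "card \<sigma> = w" using \<sigma> finite_subset by (auto simp: taylor_basis_def)
  have delta: "(if a = \<sigma> then 1 else 0) = boundary m z a" if a: "a \<in> taylor_basis m w" for a
  proof -
    have a': "a \<subseteq> {..<m}" "card a = w" "finite a" using a finite_subset by (auto simp: taylor_basis_def)
    have "(\<Sum>b\<in>taylor_basis m (Suc w). lk (taylor g w a b :: ('x, 'k) mpol) 0 * z b)
        = lk (\<Sum>b\<in>taylor_basis m (Suc w). taylor g w a b * Poly_Mapping.single 0 (z b)) 0"
      by (simp add: lookup_sum lookup_times_zero)
    also have "\<dots> = lk (taylor_app g m (\<lambda>b. Poly_Mapping.single 0 (z b)) a) 0"
      by (simp only: sum_taylor[OF a])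
    also have "\<dots> = boundary m z a"
      unfolding taylor_app_def boundary_def lookup_sum
    proof (intro sum.cong refl)
      fix x assume x: "x \<in> {..<m} - a"
      have "mono_lcm (g ` insert x a) = mono_lcm (g ` a)"
        using full[of "insert x a"] full[of a] a' x by simp
      then show "lk (Poly_Mapping.single (mono_lcm (g ` insert x a) - mono_lcm (g ` a)) (face_sign x a)
          * Poly_Mapping.single 0 (z (insert x a))) 0 = face_sign x a * z (insert x a)"
        by (simp add: mult_single)
    qed
    finally show ?thesis using eq a by simp
  qed
  have "\<sigma> \<noteq> {}" using w fin by auto
  then obtain x where x: "x \<in> \<sigma>" by blast
  define \<rho> where "\<rho> = \<sigma> - {x}"
  have \<rho>: "finite \<rho>" "\<rho> \<subseteq> {..<m}" "Suc (card \<rho>) = w" "x \<notin> \<rho>" "insert x \<rho> = \<sigma>"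
    using fin x card_Suc_Diff1[OF fin(1) x] by (auto simp: \<rho>_def)
  have "0 = boundary m (boundary m z) \<rho>" using boundary_boundary[OF \<rho>(1)] by simp
  also have "\<dots> = boundary m (\<lambda>a. if a = \<sigma> then 1 else 0) \<rho>"
  proof (rule boundary_cong)
    fix y assume y: "y < m" "y \<notin> \<rho>"
    have "insert y \<rho> \<in> taylor_basis m w" using \<rho> y by (simp add: taylor_basis_def)
    from delta[OF this] show "boundary m z (insert y \<rho>) = (if insert y \<rho> = \<sigma> then 1 else 0)" by simp
  qed
  also have "\<dots> = (\<Sum>y\<in>{..<m} - \<rho>. if y = x then face_sign x \<rho> else 0)"
    unfolding boundary_def
  proof (intro sum.cong refl)
    fix y assume y: "y \<in> {..<m} - \<rho>"
    have "insert y \<rho> = \<sigma> \<longleftrightarrow> y = x" using y \<rho>(4,5) by auto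
    then show "face_sign y \<rho> * (if insert y \<rho> = \<sigma> then 1 else 0) = (if y = x then face_sign x \<rho> else 0)"
      by simp
  qed
  also have "\<dots> = face_sign x \<rho>" using x fin \<rho> by auto
  finally show False by (simp add: face_sign_def)
qed

text \<open>The left minimum in \<open>eq\<close> is the least number of elements that guarantees \<open>P\<close>, the right one the least
number of elements that a set with \<open>P\<close> can have. When they agree, \<open>P\<close> is decided by cardinality.\<close>

lemma upward_closed_iff_card_ge:
  fixes G :: "'a set" and P :: "'a set \<Rightarrow> bool"
  assumes fin: "finite G" and G: "P G"
    and eq: "(LEAST t. \<forall>V\<subseteq>G. card V = t \<longrightarrow> P V) = (LEAST t. \<exists>V\<subseteq>G. card V = t \<and> P V)" (is "?w' = ?w")
    and up: "\<And>U V. P U \<Longrightarrow> U \<subseteq> V \<Longrightarrow> V \<subseteq> G \<Longrightarrow> P V"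
    and V: "V \<subseteq> G"
  shows "P V \<longleftrightarrow> ?w \<le> card V"
proof
  assume "P V"
  then show "?w \<le> card V" using V by (intro Least_le) blast
next
  assume le: "?w \<le> card V"
  have "\<forall>V\<subseteq>G. card V = card G \<longrightarrow> P V" using G card_subset_eq[OF fin] by blast
  then have all: "\<forall>V\<subseteq>G. card V = ?w' \<longrightarrow> P V" by (rule LeastI)
  from obtain_subset_with_card_n[OF le] obtain U where U: "U \<subseteq> V" "card U = ?w" by blast
  then have "P U" using all V unfolding eq by blast
  then show "P V" using up U(1) V by blast
qed

theorem corollary1p4:
  fixes I :: "('x::finite, 'k::field) mpol set"
  assumes "squarefree_monomial_ideal I" and "I \<noteq> {0}" and "I \<noteq> UNIV"
  shows "regularity (quot_module I) (quot_grading I) \<le> cosize I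
    \<and> (bigcosize I = cosize I \<longrightarrow>
        regularity (quot_module I) (quot_grading I) = cosize I)"
proof -
  define G where "G = min_gens I"
  have finG: "finite G" and IG: "mono_ideal G = I"
    using squarefree_min_gens[OF assms(1)] by (simp_all add: G_def)
  have I: "graded_ideal I" unfolding IG[symmetric] by (rule graded_ideal_mono_ideal)
  define L where "L = mono_lcm G"
  define d where "d = mono_deg L"
  define w where "w = (LEAST t. \<exists>V\<subseteq>G. card V = t \<and> mono_lcm V = L)"
  have cosize: "cosize I = int d - int w"
    by (simp add: cosize_def d_def w_def L_def G_def)
  have w_le: "w \<le> card V" if "V \<subseteq> G" "mono_lcm V = L" for V
    unfolding w_def using that by (intro Least_le) blast
  have one_notin: "1 \<notin> I"
  proof
    assume "1 \<in> I"
    then have "p \<in> I" for p using graded_idealD(3)[OF I, of 1 p] by simp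
    then show False using assms(3) by blast
  qed
  obtain g where g: "bij_betw g {..<card G} G"
    using ex_bij_betw_nat_finite[OF finG] by (auto simp: atLeast0LessThan)
  define m where "m = card G"
  have g_inj: "inj_on g {..<m}" and g_im: "g ` {..<m} = G"
    using g by (simp_all add: bij_betw_def m_def)
  have card_g: "card (g ` A) = card A" if "A \<subseteq> {..<m}" for A
    by (rule card_image[OF inj_on_subset[OF g_inj that]])
  have sub_g: "g ` A \<subseteq> G" if "A \<subseteq> {..<m}" for A using that g_im by blast
  have taylor: "resolves I (taylor_basis m) (taylor_deg g) (taylor g) (\<lambda>_. 1)"
    using taylor_resolves[of g m, where 'k = 'k] unfolding g_im IG .
  have "finite (SIGMA i:UNIV. taylor_basis m i)"
  proof (rule finite_subset)
    show "(SIGMA i:UNIV. taylor_basis m i) \<subseteq> (\<lambda>A. (card A, A)) ` Pow {..<m}"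
      by (auto simp: taylor_basis_def)
  qed simp
  then have "\<exists>F. minimal_graded_free_resolution (quot_module I) (quot_grading I) F"
    by (rule minimal_graded_free_resolution_exists[OF I taylor])
  define F where "F = (SOME F. minimal_graded_free_resolution (quot_module I) (quot_grading I) F)"
  have F: "minimal_graded_free_resolution (quot_module I) (quot_grading I) F"
    unfolding F_def by (rule someI_ex) fact
  have betti: "graded_betti (quot_module I) (quot_grading I) i j = card {b. b < rank F i \<and> shift F i b = j}" for i j
    by (simp add: graded_betti_def F_def Let_def)
  have "graded_free_resolution (quot_module I) (quot_grading I) F"
    using F unfolding minimal_graded_free_resolution_def by (rule conjunct1)
  from resolution_of_graded_free_resolution[OF I this]
  obtain f where res: "resolves I (\<lambda>i. {..<rank F i}) (shift F) (\<lambda>i a b. bdry F i $$ (a, b)) f" ..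
  have min: "minimal_maps (\<lambda>i. {..<rank F i}) (\<lambda>i a b. bdry F i $$ (a, b))"
    using F unfolding minimal_graded_free_resolution_def minimal_maps_def by simp
  define R where "R = {j - int i |i j. graded_betti (quot_module I) (quot_grading I) i j \<noteq> 0}"
  have R_iff: "r \<in> R \<longleftrightarrow> (\<exists>i b. b < rank F i \<and> r = shift F i b - int i)" for r
    unfolding R_def betti by (auto simp: card_eq_0_iff)
  have R_taylor: "\<exists>A\<subseteq>{..<m}. r = int (mono_deg (mono_lcm (g ` A))) - int (card A)" if r: "r \<in> R" for r
  proof -
    obtain i b where b: "b \<in> {..<rank F i}" "r = shift F i b - int i" using r R_iff[of r] by auto
    obtain A where "A \<in> taylor_basis m i" "taylor_deg g i A = shift F i b"
      using minimal_resolution_is_smallest[OF I taylor res min b(1)] by blast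
    then show ?thesis using b(2) by (auto simp: taylor_basis_def taylor_deg_def)
  qed
  have finR: "finite R"
  proof (rule finite_subset)
    show "R \<subseteq> (\<lambda>A. int (mono_deg (mono_lcm (g ` A))) - int (card A)) ` Pow {..<m}"
      using R_taylor by blast
  qed simp
  have "rank F 0 \<noteq> 0"
  proof
    assume "rank F 0 = 0"
    then have "- 1 \<in> I" using res_surj[OF I res] by simp
    then show False using graded_idealD(6)[OF I, of "- 1"] one_notin by simp
  qed
  then have neR: "R \<noteq> {}" using R_iff[of "shift F 0 0 - int 0"] by blast
  have upper: "r \<le> int d - int w" if r: "r \<in> R" for r
  proof -
    obtain A where A: "A \<subseteq> {..<m}" "r = int (mono_deg (mono_lcm (g ` A))) - int (card A)"
      using R_taylor[OF r] by blast
    obtain V where V: "V \<subseteq> G" "mono_lcm V = L"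
      "card V + mono_deg (mono_lcm (g ` A)) \<le> card (g ` A) + mono_deg L"
      using extend_to_full_lcm[OF finG sub_g[OF A(1)]] unfolding L_def by blast
    then show ?thesis using A(2) w_le[OF V(1,2)] card_g[OF A(1)] by (simp add: d_def)
  qed
  have reg: "regularity (quot_module I) (quot_grading I) = Max R"
    by (simp add: regularity_def R_def)
  have a: "Max R \<le> cosize I" unfolding cosize by (rule Max.boundedI[OF finR neR upper])
  have b: "Max R = cosize I" if big: "bigcosize I = cosize I"
  proof -
    have "(LEAST t. \<forall>V\<subseteq>G. card V = t \<longrightarrow> mono_lcm V = L) = w"
      using big unfolding cosize by (simp add: bigcosize_def d_def L_def G_def)
    then have eq: "(LEAST t. \<forall>V\<subseteq>G. card V = t \<longrightarrow> mono_lcm V = L)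
        = (LEAST t. \<exists>V\<subseteq>G. card V = t \<and> mono_lcm V = L)" by (simp only: w_def)
    have full: "mono_lcm V = L \<longleftrightarrow> w \<le> card V" if "V \<subseteq> G" for V
      unfolding w_def
    proof (rule upward_closed_iff_card_ge[OF finG _ eq _ that])
      show "mono_lcm G = L" by (simp add: L_def)
      fix U V assume U: "mono_lcm U = L" "U \<subseteq> V" "V \<subseteq> G"
      have "mono_dvd L (mono_lcm V)"
        using mono_lcm_mono[OF finite_subset[OF U(3) finG] U(2)] U(1) by simp
      moreover have "mono_dvd (mono_lcm V) L" unfolding L_def by (rule mono_lcm_mono[OF finG U(3)])
      ultimately show "mono_lcm V = L" by (rule mono_dvd_antisym[rotated])
    qed
    have "G \<noteq> {}" using assms(2) IG by (auto simp: mono_ideal_eq poly_mapping_eq_iff fun_eq_iff)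
    then obtain u where u: "u \<in> G" by blast
    have "u \<noteq> 0"
    proof
      assume "u = 0"
      then have "(mono_pol 0 :: ('x, 'k) mpol) \<in> I" unfolding IG[symmetric] mono_pol_in_mono_ideal using u mono_dvd_refl by blast
      then show False using one_notin by (simp add: mono_pol_def)
    qed
    moreover have "mono_dvd u L" unfolding L_def by (rule dvd_mono_lcm[OF finG u])
    ultimately have "L \<noteq> 0" using mono_dvd_antisym[of u 0] by (auto simp: mono_dvd_def)
    then have w_pos: "0 < w" using full[of "{}"] by auto
    have "w \<le> card {..<m}" using full[of G] by (simp add: m_def L_def)
    from obtain_subset_with_card_n[OF this] obtain \<sigma> where \<sigma>: "\<sigma> \<subseteq> {..<m}" "card \<sigma> = w" by blast
    have full': "mono_lcm (g ` A) = L \<longleftrightarrow> w \<le> card A" if "A \<subseteq> {..<m}" for A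
      using full[OF sub_g[OF that]] card_g[OF that] by simp
    have \<sigma>': "\<sigma> \<in> taylor_basis m w" using \<sigma> by (simp add: taylor_basis_def)
    have deg: "taylor_deg g w \<sigma> = int d" using full'[of \<sigma>] \<sigma> by (simp add: taylor_deg_def d_def)
    have top: "\<exists>b\<in>{..<rank F w}. shift F w b = int d"
    proof (rule ccontr)
      assume none: "\<not> (\<exists>b\<in>{..<rank F w}. shift F w b = int d)"
      have "\<exists>z. \<forall>a\<in>taylor_basis m w. (if a = \<sigma> then 1 else 0)
          = (\<Sum>b\<in>taylor_basis m (Suc w). lk (taylor g w a b :: ('x, 'k) mpol) 0 * z b)"
      proof (rule cycle_mod_maximal_is_boundary[OF I res taylor _ \<sigma>'])
        show "shift F w b \<noteq> taylor_deg g w \<sigma>" if "b \<in> {..<rank F w}" for b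
          using none that unfolding deg by blast
        fix j a assume j: "w = Suc j" and a: "a \<in> taylor_basis m j"
        show "lk (taylor g j a \<sigma> :: ('x, 'k) mpol) 0 = 0"
        proof (cases "\<exists>x. x \<notin> a \<and> \<sigma> = insert x a")
          case False
          show ?thesis unfolding taylor_other[OF False] by simp
        next
          case True
          then obtain x where x: "x \<notin> a" "\<sigma> = insert x a" by blast
          have dvd: "mono_dvd (mono_lcm (g ` a)) (mono_lcm (g ` \<sigma>))"
            by (rule mono_lcm_mono) (use x \<sigma> finite_subset in auto)
          have "mono_lcm (g ` a) \<noteq> mono_lcm (g ` \<sigma>)"
            using full'[of a] full'[of \<sigma>] \<sigma> a j by (simp add: taylor_basis_def)
          then have "mono_lcm (g ` \<sigma>) - mono_lcm (g ` a) \<noteq> 0"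
            using mono_minus_add(1)[OF dvd] by auto
          then show ?thesis unfolding x(2) taylor_insert[OF x(1)] by (simp add: lookup_single)
        qed
      qed
      then obtain z where z: "\<forall>a\<in>taylor_basis m w. (if a = \<sigma> then 1 else 0)
          = (\<Sum>b\<in>taylor_basis m (Suc w). lk (taylor g w a b :: ('x, 'k) mpol) 0 * z b)" ..
      show False by (rule taylor_top_class[OF w_pos \<sigma>' _ z]) (use full' in blast)
    qed
    then obtain b where "b < rank F w" "shift F w b = int d" by auto
    then have "int d - int w \<in> R" unfolding R_iff by (intro exI[of _ w] exI[of _ b]) simp
    then have "cosize I \<le> Max R" unfolding cosize by (rule Max_ge[OF finR])
    then show ?thesis using a by simp
  qed
  show ?thesis unfolding reg using a b by blast
qed

end
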